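(* Let $d\ge 1$ be an integer. Then $$\mu^3(A_1^{\bullet},d)\ \ge\ \frac{(d-2)(2d^2-3d+4)}{8}\quad\text{if } d \text{ is even},$$ $$\mu^3(A_1^{\bullet},d)\ \ge\ \frac{(d-1)^2(d-2)}{4}\quad\text{if } d \text{ is odd}.$$
   Context: A solitary point ($A_1^{\bullet}$-singularity) of a real algebraic surface in $\mathbb{R}P^3$ is a real singular point at which the surface is given locally (in suitable real local coordinates) by the affine equation $x^2+y^2+z^2=0$; equivalently, an ordinary (non-degenerate) double point whose quadratic part in affine coordinates is a definite quadratic form. $\mu^3(A_1^{\bullet},d)$ denotes the maximum possible number of solitary points on a real algebraic surface of degree $d$ in $\mathbb{R}P^3$. *)

theory Defs
  imports "HOL-Analysis.Analysis" "HOL-Library.Poly_Mapping"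
    "HOL-Computational_Algebra.Polynomial" "HOL-Library.Extended_Nat"
begin

type_synonym mpoly4 = "(4 \<Rightarrow>\<^sub>0 nat) \<Rightarrow>\<^sub>0 real"

definition eval4 :: "mpoly4 \<Rightarrow> real^4 \<Rightarrow> real" where
  "eval4 F x = (\<Sum>m\<in>Poly_Mapping.keys F.
     Poly_Mapping.lookup F m * (\<Prod>i\<in>UNIV. (x $ i) ^ Poly_Mapping.lookup m i))"

definition homogeneous4 :: "nat \<Rightarrow> mpoly4 \<Rightarrow> bool" where
  "homogeneous4 d F \<longleftrightarrow>
     (\<forall>m\<in>Poly_Mapping.keys F. (\<Sum>i\<in>UNIV. Poly_Mapping.lookup m i) = d)"

text \<open>Surfaces are represented by their equations; a surface may be reducible or non-reduced.\<close>

definition real_surfaces :: "nat \<Rightarrow> mpoly4 set" where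
  "real_surfaces d = {F. F \<noteq> 0 \<and> homogeneous4 d F}"

definition RP3 :: "(real^4) set set" where
  "RP3 = {L. subspace L \<and> dim L = 1}"

text \<open>The polynomial \<open>F(a + T h)\<close> in the single variable \<open>T\<close>. Its coefficient of \<open>T^k\<close>, as a
  function of \<open>h\<close>, is the homogeneous part of degree \<open>k\<close> of the polynomial \<open>F(a + h)\<close> in the
  coordinates of \<open>h\<close>.\<close>

definition line_poly :: "mpoly4 \<Rightarrow> real^4 \<Rightarrow> real^4 \<Rightarrow> real poly" where
  "line_poly F a h = (\<Sum>m\<in>Poly_Mapping.keys F.
     Polynomial.smult (Poly_Mapping.lookup F m)
       (\<Prod>i\<in>UNIV. [:a $ i, h $ i:] ^ Poly_Mapping.lookup m i))"

definition hom_part :: "mpoly4 \<Rightarrow> real^4 \<Rightarrow> nat \<Rightarrow> real^4 \<Rightarrow> real" where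
  "hom_part F a k h = Polynomial.coeff (line_poly F a h) k"

lemma poly_line_poly: "poly (line_poly F a h) t = eval4 F (a + t *\<^sub>R h)"
  by (simp add: line_poly_def eval4_def poly_sum poly_prod)

text \<open>The affine chart \<open>x\<^sub>i = 1\<close> contains the point \<open>L\<close> iff some \<open>a\<close> in \<open>L\<close> has \<open>a\<^sub>i = 1\<close>;
  the affine coordinates centred at \<open>a\<close> are then the entries of \<open>h\<close> with \<open>h\<^sub>i = 0\<close>. The condition
  does not depend on the chart. A definite quadratic part is in particular non-degenerate.\<close>

definition solitary_point :: "mpoly4 \<Rightarrow> (real^4) set \<Rightarrow> bool" where
  "solitary_point F L \<longleftrightarrow> (\<exists>i a. a \<in> L \<and> a $ i = 1 \<and>
     eval4 F a = 0 \<and>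
     (\<forall>h. h $ i = 0 \<longrightarrow> hom_part F a 1 h = 0) \<and>
     ((\<forall>h. h $ i = 0 \<and> h \<noteq> 0 \<longrightarrow> hom_part F a 2 h > 0) \<or>
      (\<forall>h. h $ i = 0 \<and> h \<noteq> 0 \<longrightarrow> hom_part F a 2 h < 0)))"

definition solitary_points :: "mpoly4 \<Rightarrow> (real^4) set set" where
  "solitary_points F = {L \<in> RP3. solitary_point F L}"

definition ecard :: "'a set \<Rightarrow> enat" where
  "ecard A = (if finite A then enat (card A) else \<infinity>)"

text \<open>A supremum of a non-empty set of extended naturals is attained or infinite; the latter does
  not happen here (Bezout), so this supremum is a maximum.\<close>

definition mu3_A1_solitary :: "nat \<Rightarrow> enat" where
  "mu3_A1_solitary d = (SUP F \<in> real_surfaces d. ecard (solitary_points F))"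

end

theory Submission
  imports Defs
begin

text \<open>The line \<open>t \<mapsto> (t, 1 - t)\<close>, raised to \<open>d\<close>-th powers coordinatewise, traces a rational plane curve
  \<open>f = 0\<close> of degree \<open>d\<close>. All its \<open>(d - 1) (d - 2) / 2\<close> nodes are solitary: they come from the apexes
  \<open>t\<close> of the triangles on the base \<open>0, 1\<close> whose angles are multiples of \<open>\<pi> / d\<close>. Polynomials of
  degree \<open>d - 3\<close> can be prescribed freely at the nodes, so a small perturbation of \<open>f\<close> turns every
  local minimum at a node into one of value \<open>+\<epsilon>\<close> and every local maximum into one of value \<open>-\<epsilon>\<close>.
  Dividing by \<open>\<epsilon>\<close> and adding the Chebyshev polynomial \<open>T_d\<close> of the third coordinate gives the surface:
  above a minimum each of the \<open>\<lfloor>d / 2\<rfloor>\<close> minima of \<open>T_d\<close> produces a solitary point, above a maximum each of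
  its \<open>\<lfloor>(d - 1) / 2\<rfloor>\<close> maxima. For even \<open>d\<close> only the nodes whose two base angles are both even multiples
  of \<open>\<pi> / d\<close> can be maxima.\<close>

section \<open>Quadratic growth and perturbation of local extrema\<close>

text \<open>At a solitary point of \<open>h (x, y) + T_d (z)\<close> both summands are critical,
  with opposite values and with definite quadratic parts of the same sign. The nodes of
  \<open>f\<close> all have value 0, whereas the minima and maxima of \<open>T_d\<close> have values
  -1 and 1, so no constant added to \<open>T_d\<close> lets minima and maxima of \<open>f\<close>
  contribute together. Separating the two kinds of nodes by value, without leaving degree
  \<open>d\<close>, is what makes every node count. Only the value of an extremum is prescribed, not
  its position: the minimum over a ball is Lipschitz in the coefficients of the perturbation, which
  is all that a contraction needs. The nodes are solitary because non-real \<open>t\<close> and its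
  conjugate have the same real image \<open>(t^d, (1-t)^d)\<close>, and the two conjugate branches
  through that point have non-real tangents. Interpolation in degree \<open>d - 3\<close> is
  possible because there are exactly as many monomials as nodes.\<close>

lemma poly_quadratic_growth:
  fixes p :: "real poly"
  assumes "poly p 0 = 0" "m > 0" "\<forall>\<^sub>F s in at 0. poly p s \<ge> m * s\<^sup>2"
  shows "coeff p 1 = 0" "coeff p 2 > 0"
proof -
  obtain a p1 where p: "p = pCons a p1" by (cases p)
  obtain b q where p1: "p1 = pCons b q" by (cases p1)
  have a: "a = 0" using assms(1) p by simp
  have pv: "poly p s = s * (b + s * poly q s)" for s using p p1 a by simp
  have lim: "((\<lambda>s. b + s * poly q s) \<longlongrightarrow> b) (at 0 within S)" for S
    by (auto intro!: tendsto_eq_intros)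
  have limm: "((\<lambda>s. m * s) \<longlongrightarrow> 0) (at 0 within S)" for S
    by (auto intro!: tendsto_eq_intros)
  \<comment> \<open>The one-sided filters are kept apart because division by \<open>s\<close>
    reverses the inequality for negative \<open>s\<close>: the right limit gives
    \<open>b \<ge> 0\<close>, the left one \<open>b \<le> 0\<close>.\<close>
  have r: "\<forall>\<^sub>F s in at_right 0. poly p s \<ge> m * s\<^sup>2" and l: "\<forall>\<^sub>F s in at_left 0. poly p s \<ge> m * s\<^sup>2"
    using assms(3) by (auto simp: eventually_at_split)
  have "\<forall>\<^sub>F s in at_right 0. m * s \<le> b + s * poly q s"
    using r eventually_at_right_less
  proof eventually_elim
    case (elim s)
    then have "s * (m * s) \<le> s * (b + s * poly q s)" by (simp add: pv power2_eq_square algebra_simps)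
    then show ?case using elim(2) by simp
  qed
  from tendsto_le[OF _ lim limm this] have b1: "b \<ge> 0" by simp
  have "\<forall>\<^sub>F s in at_left 0. s < (0::real)" by (simp add: eventually_at_filter)
  with l have "\<forall>\<^sub>F s in at_left 0. b + s * poly q s \<le> m * s"
  proof eventually_elim
    case (elim s)
    then have "s * (m * s) \<le> s * (b + s * poly q s)" by (simp add: pv power2_eq_square algebra_simps)
    then show ?case using elim(2) by simp
  qed
  from tendsto_le[OF _ limm lim this] have b2: "b \<le> 0" by simp
  with b1 have b: "b = 0" by simp
  have "\<forall>\<^sub>F s in at 0. s \<noteq> (0::real)" by (simp add: eventually_at_filter)
  with assms(3) have "\<forall>\<^sub>F s in at 0. m \<le> poly q s"
  proof eventually_elim
    case (elim s)
    then have "s\<^sup>2 * m \<le> s\<^sup>2 * poly q s" by (simp add: pv b power2_eq_square algebra_simps)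
    then show ?case using elim(2) by simp
  qed
  then have "m \<le> poly q 0"
    by (intro tendsto_lowerbound[of "poly q" _ "at 0"]) (auto intro!: tendsto_eq_intros)
  then show "coeff p 1 = 0" "coeff p 2 > 0"
    using assms(2) by (simp_all add: p p1 b poly_0_coeff_0 numeral_2_eq_2)
qed

text \<open>\<open>H x v\<close> is the second derivative of \<open>f\<close> at \<open>x\<close> along the line with direction \<open>v\<close>, and \<open>D x v\<close> the
  first one.\<close>

definition has_hessian :: "('a::euclidean_space \<Rightarrow> real) \<Rightarrow> ('a \<Rightarrow> 'a \<Rightarrow> real) \<Rightarrow> bool" where
  "has_hessian f H \<longleftrightarrow> continuous_on UNIV (\<lambda>z. H (fst z) (snd z)) \<and>
     (\<forall>x r v. H x (r *\<^sub>R v) = r\<^sup>2 * H x v) \<and>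
     (\<exists>D. \<forall>x v s. ((\<lambda>s. f (x + s *\<^sub>R v)) has_real_derivative D (x + s *\<^sub>R v) v) (at s) \<and>
        ((\<lambda>s. D (x + s *\<^sub>R v) v) has_real_derivative H (x + s *\<^sub>R v) v) (at s))"

lemma has_hessianE:
  assumes "has_hessian f H"
  obtains D where
    "\<And>x v s. ((\<lambda>s. f (x + s *\<^sub>R v)) has_real_derivative D (x + s *\<^sub>R v) v) (at s)"
    "\<And>x v s. ((\<lambda>s. D (x + s *\<^sub>R v) v) has_real_derivative H (x + s *\<^sub>R v) v) (at s)"
proof -
  from assms have "\<exists>D. \<forall>x v s. ((\<lambda>s. f (x + s *\<^sub>R v)) has_real_derivative D (x + s *\<^sub>R v) v) (at s) \<and>
        ((\<lambda>s. D (x + s *\<^sub>R v) v) has_real_derivative H (x + s *\<^sub>R v) v) (at s)"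
    unfolding has_hessian_def by (elim conjE)
  then obtain D where D: "\<forall>x v s. ((\<lambda>s. f (x + s *\<^sub>R v)) has_real_derivative D (x + s *\<^sub>R v) v) (at s) \<and>
        ((\<lambda>s. D (x + s *\<^sub>R v) v) has_real_derivative H (x + s *\<^sub>R v) v) (at s)"
    by (elim exE)
  show ?thesis
    by (rule that[of D]) (rule D[rule_format, THEN conjunct1] D[rule_format, THEN conjunct2])+
qed

lemma has_hessian_scale:
  assumes "has_hessian f H"
  shows "H x (r *\<^sub>R v) = r\<^sup>2 * H x v"
  using assms unfolding has_hessian_def by (elim conjE allE[of _ x] allE[of _ r] allE[of _ v])

lemma has_hessian_continuous:
  assumes "has_hessian f H"
  shows "continuous_on UNIV (\<lambda>z. H (fst z) (snd z))"
  using assms unfolding has_hessian_def by (elim conjE)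

lemma has_hessianI:
  assumes "continuous_on UNIV (\<lambda>z. H (fst z) (snd z))"
    and "\<And>x r v. H x (r *\<^sub>R v) = r\<^sup>2 * H x v"
    and "\<And>x v s. ((\<lambda>s. f (x + s *\<^sub>R v)) has_real_derivative D (x + s *\<^sub>R v) v) (at s)"
    and "\<And>x v s. ((\<lambda>s. D (x + s *\<^sub>R v) v) has_real_derivative H (x + s *\<^sub>R v) v) (at s)"
  shows "has_hessian f H"
  unfolding has_hessian_def by (intro conjI exI[of _ D] allI; rule assms)

lemma has_hessian_add:
  assumes f: "has_hessian f H" and g: "has_hessian g K"
  shows "has_hessian (\<lambda>x. f x + g x) (\<lambda>x v. H x v + K x v)"
proof -
  from f obtain D where D: "\<And>x v s. ((\<lambda>s. f (x + s *\<^sub>R v)) has_real_derivative D (x + s *\<^sub>R v) v) (at s)"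
    "\<And>x v s. ((\<lambda>s. D (x + s *\<^sub>R v) v) has_real_derivative H (x + s *\<^sub>R v) v) (at s)"
    by (rule has_hessianE) (rule that)
  from g obtain E where E: "\<And>x v s. ((\<lambda>s. g (x + s *\<^sub>R v)) has_real_derivative E (x + s *\<^sub>R v) v) (at s)"
    "\<And>x v s. ((\<lambda>s. E (x + s *\<^sub>R v) v) has_real_derivative K (x + s *\<^sub>R v) v) (at s)"
    by (rule has_hessianE) (rule that)
  show ?thesis
    by (rule has_hessianI[where D = "\<lambda>x v. D x v + E x v"])
      (simp_all only: has_hessian_scale[OF f] has_hessian_scale[OF g] distrib_left
        continuous_on_add[OF has_hessian_continuous[OF f] has_hessian_continuous[OF g]]
        DERIV_add[OF D(1) E(1)] DERIV_add[OF D(2) E(2)])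
qed

lemma has_hessian_cmult:
  assumes f: "has_hessian f H"
  shows "has_hessian (\<lambda>x. c * f x) (\<lambda>x v. c * H x v)"
proof -
  from f obtain D where D: "\<And>x v s. ((\<lambda>s. f (x + s *\<^sub>R v)) has_real_derivative D (x + s *\<^sub>R v) v) (at s)"
    "\<And>x v s. ((\<lambda>s. D (x + s *\<^sub>R v) v) has_real_derivative H (x + s *\<^sub>R v) v) (at s)"
    by (rule has_hessianE) (rule that)
  show ?thesis
    by (rule has_hessianI[where D = "\<lambda>x v. c * D x v"])
      (simp_all only: has_hessian_scale[OF f] mult.left_commute[of _ c]
        continuous_on_mult_left[OF has_hessian_continuous[OF f]] DERIV_cmult[OF D(1)] DERIV_cmult[OF D(2)])
qed

lemma has_hessian_const: "has_hessian (\<lambda>x. c) (\<lambda>x v. 0)"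
  by (rule has_hessianI[where D = "\<lambda>x v. 0"]) auto

lemma has_hessian_sum:
  assumes "finite A" "\<And>i. i \<in> A \<Longrightarrow> has_hessian (f i) (H i)"
  shows "has_hessian (\<lambda>x. \<Sum>i\<in>A. f i x) (\<lambda>x v. \<Sum>i\<in>A. H i x v)"
  using assms
proof (induction A)
  case empty then show ?case by (simp add: has_hessian_const)
next
  case (insert i A)
  then show ?case using has_hessian_add[of "f i" "H i"] by simp
qed

text \<open>Strong convexity in a form free of gradients, so that it can be used at a minimizer on
  the boundary of \<open>B\<close> as well as in its interior. Equality holds for \<open>m/2\<close>
  times the squared norm, whence the factor \<open>m / 4\<close>.\<close>

lemma has_hessian_midpoint:
  assumes H: "has_hessian f H" and B: "convex B" "x \<in> B" "y \<in> B"
    and m: "\<And>x v. x \<in> B \<Longrightarrow> norm v = 1 \<Longrightarrow> H x v \<ge> m"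
  shows "f x + f y - 2 * f ((1/2) *\<^sub>R (x + y)) \<ge> m / 4 * (norm (x - y))\<^sup>2"
proof -
  from H obtain D where D: "\<And>x v s. ((\<lambda>s. f (x + s *\<^sub>R v)) has_real_derivative D (x + s *\<^sub>R v) v) (at s)"
    "\<And>x v s. ((\<lambda>s. D (x + s *\<^sub>R v) v) has_real_derivative H (x + s *\<^sub>R v) v) (at s)"
    by (rule has_hessianE) (rule that)
  define v where "v = y - x"
  define c where "c = m * (norm v)\<^sup>2"
  have Hv: "H z v \<ge> c" if "z \<in> B" for z
  proof (cases "v = 0")
    case True
    then have "H z v = 0" using has_hessian_scale[OF H, of z 0 v] by simp
    then show ?thesis using True by (simp add: c_def)
  next
    case False
    have "H z v = H z (norm v *\<^sub>R (v /\<^sub>R norm v))" using False by simp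
    also have "\<dots> = (norm v)\<^sup>2 * H z (v /\<^sub>R norm v)"
      by (rule has_hessian_scale[OF H])
    also have "\<dots> \<ge> (norm v)\<^sup>2 * m" using False m[OF that, of "v /\<^sub>R norm v"] by (intro mult_left_mono) auto
    finally show ?thesis by (simp add: c_def mult.commute)
  qed
  have seg: "x + s *\<^sub>R v \<in> B" if "s \<in> {0..1}" for s
  proof -
    have "(1 - s) *\<^sub>R x + s *\<^sub>R y \<in> B" using that B by (intro convexD) auto
    then show ?thesis by (simp add: v_def algebra_simps)
  qed
  \<comment> \<open>The correction term has second derivative \<open>c\<close>, the lower bound of
    \<open>H\<close> along the segment, so the difference is still convex; its convexity at
    \<open>s = 1/2\<close> is the claim.\<close>
  have "convex_on {0..1} (\<lambda>s. f (x + s *\<^sub>R v) - c / 2 * s\<^sup>2)"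
  proof (rule f''_ge0_imp_convex)
    show "((\<lambda>s. f (x + s *\<^sub>R v) - c / 2 * s\<^sup>2) has_real_derivative D (x + s *\<^sub>R v) v - c * s) (at s)" for s
    proof -
      have "((\<lambda>s. c / 2 * s\<^sup>2) has_real_derivative c * s) (at s)" by (auto intro!: derivative_eq_intros)
      from DERIV_diff[OF D(1) this] show ?thesis .
    qed
    show "((\<lambda>s. D (x + s *\<^sub>R v) v - c * s) has_real_derivative H (x + s *\<^sub>R v) v - c) (at s)" for s
    proof -
      have "((\<lambda>s. c * s) has_real_derivative c) (at s)" by (auto intro!: derivative_eq_intros)
      from DERIV_diff[OF D(2) this] show ?thesis .
    qed
    show "0 \<le> H (x + s *\<^sub>R v) v - c" if "s \<in> {0..1}" for s using Hv seg that by simp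
  qed simp
  from convex_onD[OF this, of "1/2" 0 1]
  have "f (x + (1/2) *\<^sub>R v) - c / 8 \<le> 1/2 * f x + 1/2 * (f (x + v) - c / 2)"
    by (simp add: power2_eq_square)
  moreover have "x + v = y" "x + (1/2) *\<^sub>R v = (1/2) *\<^sub>R (x + y)" "norm v = norm (x - y)"
    by (simp_all add: v_def algebra_simps norm_minus_commute flip: scaleR_add_left)
  ultimately have mid: "f ((1/2) *\<^sub>R (x + y)) - c / 8 \<le> 1/2 * f x + 1/2 * (f y - c / 2)"
    and "c = m * (norm (x - y))\<^sup>2" by (simp_all add: c_def)
  then have "m / 4 * (norm (x - y))\<^sup>2 = c / 4" by simp
  then show ?thesis using mid by argo
qed

lemma has_hessian_bounded:
  assumes "has_hessian f H"
  shows "\<exists>K. \<forall>x\<in>cball p r. \<forall>v. norm v = 1 \<longrightarrow> \<bar>H x v\<bar> \<le> K"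
proof -
  have "compact ((\<lambda>z. H (fst z) (snd z)) ` (cball p r \<times> sphere 0 1))"
    by (intro compact_continuous_image continuous_on_subset[OF has_hessian_continuous[OF assms]]
        compact_Times) auto
  from compact_imp_bounded[OF this]
  obtain K where K: "\<forall>y\<in>(\<lambda>z. H (fst z) (snd z)) ` (cball p r \<times> sphere 0 1). norm y \<le> K"
    unfolding bounded_iff by (elim exE)
  then have "\<bar>H x v\<bar> \<le> K" if "x \<in> cball p r" "norm v = 1" for x v
  proof -
    have "(\<lambda>z. H (fst z) (snd z)) (x, v) \<in> (\<lambda>z. H (fst z) (snd z)) ` (cball p r \<times> sphere 0 1)"
      using that by (intro imageI) simp
    from bspec[OF K this] show ?thesis by simp
  qed
  then show ?thesis by (intro exI[of _ K]) simp
qed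

text \<open>The form at \<open>p\<close> has a positive minimum on the unit sphere, and by uniform
  continuity on a compact set at least half of it survives at nearby points, uniformly in the
  direction.\<close>

lemma has_hessian_pos_def:
  assumes "has_hessian f H" "\<And>v. v \<noteq> 0 \<Longrightarrow> H p v > 0"
  shows "\<exists>m r. m > 0 \<and> r > 0 \<and> (\<forall>x\<in>cball p r. \<forall>v. norm v = 1 \<longrightarrow> H x v \<ge> m)"
proof -
  let ?S = "sphere (0::'a) 1"
  let ?H = "\<lambda>z. H (fst z) (snd z)"
  have ne: "?S \<noteq> {}" by (metis SOME_Basis mem_sphere_0 norm_Basis empty_iff)
  have "continuous_on ?S (\<lambda>v. ?H (p, v))"
    by (intro continuous_on_compose2[OF has_hessian_continuous[OF assms(1)]] continuous_intros) auto
  from continuous_attains_inf[OF compact_sphere ne this]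
  obtain w where w: "w \<in> ?S" "\<And>v. v \<in> ?S \<Longrightarrow> H p w \<le> H p v" by auto
  have "w \<noteq> 0" using w(1) by auto
  then have w0: "H p w > 0" by (rule assms(2))
  have "uniformly_continuous_on (cball p 1 \<times> ?S) ?H"
    by (intro compact_uniformly_continuous continuous_on_subset[OF has_hessian_continuous[OF assms(1)]]
        compact_Times) auto
  then have "\<exists>d>0. \<forall>z\<in>cball p 1 \<times> ?S. \<forall>z'\<in>cball p 1 \<times> ?S. dist z' z < d \<longrightarrow> dist (?H z') (?H z) < H p w / 2"
    unfolding uniformly_continuous_on_def using w0 by (elim allE[of _ "H p w / 2"]) simp
  then obtain d where d0: "d > 0" and d: "\<forall>z\<in>cball p 1 \<times> ?S. \<forall>z'\<in>cball p 1 \<times> ?S. dist z' z < d \<longrightarrow>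
      dist (?H z') (?H z) < H p w / 2"
    by (elim exE conjE)
  show ?thesis
  proof (rule exI[of _ "H p w / 2"], rule exI[of _ "min 1 (d/2)"], intro conjI ballI allI impI)
    fix x v :: 'a assume x: "x \<in> cball p (min 1 (d/2))" and v: "norm v = 1"
    have "dist (?H (x, v)) (?H (p, v)) < H p w / 2"
      using x v d0 by (intro d[rule_format]) (auto simp: dist_Pair_Pair dist_commute)
    moreover have "H p v \<ge> H p w" using w(2)[of v] v by simp
    ultimately show "H p w / 2 \<le> H x v" by (simp add: dist_real_def abs_real_def split: if_splits)
  qed (use w0 d0 in auto)
qed

text \<open>The midpoint also lies in \<open>B\<close>, so its value is at least \<open>h x\<close>;
  this turns the midpoint inequality into growth away from the minimizer.\<close>

lemma midpoint_convex_growth: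
  fixes h :: "'a::real_normed_vector \<Rightarrow> real"
  assumes "convex B" "x \<in> B" "y \<in> B" "\<And>z. z \<in> B \<Longrightarrow> h x \<le> h z"
    and "h x + h y - 2 * h ((1/2) *\<^sub>R (x + y)) \<ge> c * (norm (x - y))\<^sup>2"
  shows "h y \<ge> h x + c * (norm (x - y))\<^sup>2"
proof -
  have "(1/2) *\<^sub>R (x + y) \<in> B" using convexD[OF assms(1-3), of "1/2" "1/2"] by (simp add: algebra_simps)
  from assms(4)[OF this] assms(5) show ?thesis by simp
qed

text \<open>Banach's fixed point theorem for the maximum norm on the first \<open>n\<close>
  coordinates, by iteration from 0. With \<open>M = 0\<close> the hypothesis says that the first
  \<open>n\<close> values of \<open>T c\<close> depend only on those of \<open>c\<close>, so
  functions on \<open>nat\<close> can stand for vectors of variable length \<open>n\<close>.\<close>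

lemma finite_contraction_fixpoint:
  fixes T :: "(nat \<Rightarrow> real) \<Rightarrow> nat \<Rightarrow> real"
  assumes "\<And>c c' M i. i < n \<Longrightarrow> (\<And>j. j < n \<Longrightarrow> \<bar>c j - c' j\<bar> \<le> M) \<Longrightarrow> \<bar>T c i - T c' i\<bar> \<le> M / 2"
  shows "\<exists>c. \<forall>i<n. T c i = c i"
proof -
  define x where "x = (\<lambda>k. (T ^^ k) (\<lambda>_. 0))"
  have x_Suc: "x (Suc k) = T (x k)" for k by (simp add: x_def)
  define C where "C = (\<Sum>j<n. \<bar>x 1 j - x 0 j\<bar>)"
  have step: "\<bar>x (Suc k) j - x k j\<bar> \<le> C * (1/2) ^ k" if "j < n" for k j
    using that
  proof (induction k arbitrary: j)
    case 0
    then show ?case using member_le_sum[of j "{..<n}" "\<lambda>j. \<bar>x 1 j - x 0 j\<bar>"] by (simp add: C_def)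
  next
    case (Suc k)
    have "\<bar>T (x (Suc k)) j - T (x k) j\<bar> \<le> C * (1/2) ^ k / 2"
      by (rule assms[OF Suc.prems Suc.IH])
    then show ?case by (simp add: x_Suc)
  qed
  have "\<exists>l. (\<lambda>k. x k j) \<longlonglongrightarrow> l" if "j < n" for j
  proof -
    have "summable (\<lambda>k. x (Suc k) j - x k j)"
      by (rule summable_comparison_test'[where g = "\<lambda>k. C * (1/2) ^ k" and N = 0])
        (use step[OF that] in \<open>auto intro!: summable_mult summable_geometric\<close>)
    then have "convergent (\<lambda>k. \<Sum>i<k. x (Suc i) j - x i j)" by (simp add: summable_iff_convergent)
    then have "convergent (\<lambda>k. x k j - x 0 j)" by (simp add: sum_lessThan_telescope[of "\<lambda>k. x k j"])
    then obtain l where "(\<lambda>k. x k j - x 0 j) \<longlonglongrightarrow> l" by (auto simp: convergent_def)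
    from tendsto_add[OF this tendsto_const[of "x 0 j"]] show ?thesis by auto
  qed
  then obtain l where l: "\<And>j. j < n \<Longrightarrow> (\<lambda>k. x k j) \<longlonglongrightarrow> l j" by metis
  have "T l i = l i" if i: "i < n" for i
  proof -
    have "(\<lambda>k. (\<Sum>j<n. \<bar>x k j - l j\<bar>) / 2) \<longlonglongrightarrow> (\<Sum>j<n. \<bar>l j - l j\<bar>) / 2"
      by (intro tendsto_intros l) auto
    then have lim0: "(\<lambda>k. (\<Sum>j<n. \<bar>x k j - l j\<bar>) / 2) \<longlonglongrightarrow> 0" by simp
    have "\<bar>T (x k) i - T l i\<bar> \<le> (\<Sum>j<n. \<bar>x k j - l j\<bar>) / 2" for k
    proof (rule assms[OF i])
      fix j assume "j < n"
      then show "\<bar>x k j - l j\<bar> \<le> (\<Sum>j<n. \<bar>x k j - l j\<bar>)"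
        using member_le_sum[of j "{..<n}" "\<lambda>j. \<bar>x k j - l j\<bar>"] by simp
    qed
    then have "\<forall>\<^sub>F k in sequentially. norm (T (x k) i - T l i) \<le> (\<Sum>j<n. \<bar>x k j - l j\<bar>) / 2"
      by (intro always_eventually allI) (simp only: real_norm_def)
    from Lim_null_comparison[OF this lim0]
    have "(\<lambda>k. T (x k) i) \<longlonglongrightarrow> T l i" by (rule LIM_zero_cancel)
    then have "(\<lambda>k. x (Suc k) i) \<longlonglongrightarrow> T l i" by (simp only: x_Suc)
    moreover have "(\<lambda>k. x (Suc k) i) \<longlonglongrightarrow> l i" by (rule LIMSEQ_Suc[OF l[OF i]])
    ultimately show ?thesis by (rule LIMSEQ_unique)
  qed
  then show ?thesis by blast
qed

lemma eventually_cball_at_right: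
  fixes p :: "'a::metric_space"
  assumes "\<forall>\<^sub>F x in nhds p. P x"
  shows "\<forall>\<^sub>F r in at_right 0. \<forall>x\<in>cball p r. P x"
proof -
  obtain d where d: "d > 0" "\<And>x. dist x p < d \<Longrightarrow> P x" using assms unfolding eventually_nhds_metric by blast
  have "\<forall>\<^sub>F r in at_right 0. r < d" using d(1) by (rule eventually_at_right_real[THEN eventually_mono]) simp
  then show ?thesis by eventually_elim (auto intro!: d(2) simp: dist_commute)
qed

lemma Inf_image_le_shift:
  fixes u w :: "'a \<Rightarrow> real"
  assumes "B \<noteq> {}" "bdd_below (u ` B)" "\<And>x. x \<in> B \<Longrightarrow> u x \<le> w x + k"
  shows "Inf (u ` B) \<le> Inf (w ` B) + k"
proof -
  have "Inf (u ` B) - k \<le> Inf (w ` B)"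
  proof (rule cINF_greatest[OF assms(1)])
    fix x assume "x \<in> B"
    then show "Inf (u ` B) - k \<le> w x" using cINF_lower[OF assms(2), of x] assms(3)[of x] by simp
  qed
  then show ?thesis by simp
qed

lemma signed_le:
  fixes s a b k :: real
  assumes "s = 1 \<or> s = -1" "\<bar>a - b\<bar> \<le> k"
  shows "s * a \<le> s * b + k"
  using assms unfolding abs_le_iff by (elim disjE conjE) auto

text \<open>The extremal value of \<open>f + \<epsilon> \<Sum> c\<^sub>j g\<^sub>j\<close> on a small ball around \<open>p i\<close> is \<open>\<epsilon> c\<^sub>i\<close> up to an error which is
  Lipschitz in \<open>c\<close> with constant \<open>\<epsilon> / 2\<close>, because \<open>g\<^sub>j\<close> is close to \<open>\<delta>\<^sub>i\<^sub>j\<close> there; so the equations for \<open>c\<close>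
  are a fixed point problem for a contraction. Strong convexity on the balls survives the
  perturbation.\<close>

lemma prescribe_extremal_values:
  fixes p :: "nat \<Rightarrow> 'a::euclidean_space"
  assumes f: "has_hessian f Hf" and g: "\<And>j. j < n \<Longrightarrow> has_hessian (g j) (Hg j)"
    and inj: "inj_on p {..<n}"
    and \<sigma>: "\<And>i. i < n \<Longrightarrow> \<sigma> i = 1 \<or> \<sigma> i = (-1::real)"
    and f0: "\<And>i. i < n \<Longrightarrow> f (p i) = 0"
    and ext: "\<And>i. i < n \<Longrightarrow> \<forall>\<^sub>F x in nhds (p i). \<sigma> i * f x \<ge> 0"
    and pd: "\<And>i v. i < n \<Longrightarrow> v \<noteq> 0 \<Longrightarrow> \<sigma> i * Hf (p i) v > 0"
    and dual: "\<And>i j. i < n \<Longrightarrow> j < n \<Longrightarrow> g j (p i) = (if i = j then 1 else 0)"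
    and cont: "continuous_on UNIV f" "\<And>j. j < n \<Longrightarrow> continuous_on UNIV (g j)"
  shows "\<exists>e c x m. e > 0 \<and> m > 0 \<and> inj_on x {..<n} \<and>
    (\<forall>i<n. f (x i) + (\<Sum>j<n. c j * g j (x i)) = e * \<sigma> i \<and>
       (\<forall>\<^sub>F y in nhds (x i). \<sigma> i * (f y + (\<Sum>j<n. c j * g j y)) \<ge> e + m * (norm (x i - y))\<^sup>2))"
proof -
  \<comment> \<open>The \<open>n\<close> errors of size \<open>\<eta>\<close> in the values of the
    \<open>g j\<close> must add up to at most 1/2, the contraction constant; \<open>n + 1\<close>
    avoids a division by zero.\<close>
  define \<eta> where "\<eta> = 1 / (2 * (real n + 1))"
  have \<eta>: "\<eta> > 0" "real n * \<eta> \<le> 1 / 2" by (auto simp: \<eta>_def field_simps)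
  have "\<exists>M R. \<forall>i<n. M i > 0 \<and> R i > 0 \<and> (\<forall>x\<in>cball (p i) (R i). \<forall>v. norm v = 1 \<longrightarrow> \<sigma> i * Hf x v \<ge> M i)"
    using has_hessian_pos_def[OF has_hessian_cmult[OF f] pd] by metis
  then obtain M R where MR: "\<And>i. i < n \<Longrightarrow> M i > (0::real)" "\<And>i. i < n \<Longrightarrow> R i > (0::real)"
    "\<And>i x v. i < n \<Longrightarrow> x \<in> cball (p i) (R i) \<Longrightarrow> norm v = 1 \<Longrightarrow> \<sigma> i * Hf x v \<ge> M i" by blast
  have "\<forall>\<^sub>F m in at_right 0. m < M i" if "i < n" for i
    using MR(1)[OF that] by (rule eventually_at_right_real[THEN eventually_mono]) simp
  then have "\<forall>\<^sub>F m in at_right (0::real). \<forall>i\<in>{..<n}. m < M i" by (intro eventually_ball_finite) auto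
  from eventually_happens[OF eventually_conj[OF this eventually_at_right_less]]
  obtain m where m: "m > 0" "\<And>i. i < n \<Longrightarrow> m \<le> M i" by force
  have gnear: "\<forall>\<^sub>F x in nhds (p i). \<bar>g j x - (if i = j then 1 else 0)\<bar> < \<eta>" if "i < n" "j < n" for i j
  proof -
    have "isCont (g j) (p i)" using cont(2)[OF that(2)] by (simp add: continuous_on_eq_continuous_at)
    then have "(g j \<longlongrightarrow> (if i = j then 1 else 0)) (nhds (p i))"
      unfolding isCont_def using dual[OF that] by (metis tendsto_nhds_iff)
    from tendstoD[OF this \<eta>(1)] show ?thesis by (simp add: dist_real_def)
  qed
  \<comment> \<open>Each requirement on the radius holds for all sufficiently small
    \<open>r\<close>, so finitely many of them can be met by one \<open>r\<close>. The last one
    keeps the balls disjoint, which later makes \<open>x\<close> injective.\<close>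
  have "\<forall>\<^sub>F r in at_right 0. r < R i \<and> (\<forall>x\<in>cball (p i) r. \<sigma> i * f x \<ge> 0) \<and>
      (\<forall>x\<in>cball (p i) r. \<forall>j\<in>{..<n}. \<bar>g j x - (if i = j then 1 else 0)\<bar> < \<eta>) \<and>
      (\<forall>j\<in>{..<n} - {i}. 2 * r < dist (p i) (p j))" if i: "i < n" for i
  proof (intro eventually_conj)
    show "\<forall>\<^sub>F r in at_right 0. r < R i"
      using MR(2)[OF i] by (rule eventually_at_right_real[THEN eventually_mono]) simp
    show "\<forall>\<^sub>F r in at_right 0. \<forall>x\<in>cball (p i) r. \<sigma> i * f x \<ge> 0"
      by (rule eventually_cball_at_right[OF ext[OF i]])
    show "\<forall>\<^sub>F r in at_right 0. \<forall>x\<in>cball (p i) r. \<forall>j\<in>{..<n}. \<bar>g j x - (if i = j then 1 else 0)\<bar> < \<eta>"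
      by (intro eventually_cball_at_right eventually_ball_finite) (use gnear i in auto)
    have "\<forall>\<^sub>F r in at_right 0. 2 * r < dist (p i) (p j)" if "j \<in> {..<n} - {i}" for j
    proof -
      have "0 < dist (p i) (p j) / 2" using inj that i by (auto simp: inj_on_def)
      then show ?thesis by (rule eventually_at_right_real[THEN eventually_mono]) simp
    qed
    then show "\<forall>\<^sub>F r in at_right 0. \<forall>j\<in>{..<n} - {i}. 2 * r < dist (p i) (p j)"
      by (intro eventually_ball_finite) auto
  qed
  then have "\<forall>\<^sub>F r in at_right 0. \<forall>i\<in>{..<n}. r < R i \<and> (\<forall>x\<in>cball (p i) r. \<sigma> i * f x \<ge> 0) \<and>
      (\<forall>x\<in>cball (p i) r. \<forall>j\<in>{..<n}. \<bar>g j x - (if i = j then 1 else 0)\<bar> < \<eta>) \<and>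
      (\<forall>j\<in>{..<n} - {i}. 2 * r < dist (p i) (p j))" by (intro eventually_ball_finite) auto
  from eventually_happens[OF eventually_conj[OF this eventually_at_right_less]]
  obtain r where r0: "r > 0" and r: "\<And>i. i < n \<Longrightarrow> r < R i \<and> (\<forall>x\<in>cball (p i) r. \<sigma> i * f x \<ge> 0) \<and>
      (\<forall>x\<in>cball (p i) r. \<forall>j\<in>{..<n}. \<bar>g j x - (if i = j then 1 else 0)\<bar> < \<eta>) \<and>
      (\<forall>j\<in>{..<n} - {i}. 2 * r < dist (p i) (p j))" by auto
  define B where "B = (\<lambda>i. cball (p i) r)"
  have B: "p i \<in> B i" "convex (B i)" "compact (B i)" "B i \<noteq> {}" for i using r0 by (auto simp: B_def)
  have fB: "\<sigma> i * f x \<ge> 0" if "i < n" "x \<in> B i" for i x using r that by (auto simp: B_def)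
  have gB: "\<bar>g j x - (if i = j then 1 else 0)\<bar> < \<eta>" if "i < n" "j < n" "x \<in> B i" for i j x
    using r[OF that(1)] that unfolding B_def by blast
  have HB: "\<sigma> i * Hf x v \<ge> m" if "i < n" "x \<in> B i" "norm v = 1" for i x v
  proof -
    have "x \<in> cball (p i) (R i)" using r[OF that(1)] that(2) by (auto simp: B_def)
    from MR(3)[OF that(1) this that(3)] m(2)[OF that(1)] show ?thesis by simp
  qed
  have growf: "\<sigma> i * f x \<ge> m / 4 * (norm (p i - x))\<^sup>2" if "i < n" "x \<in> B i" for i x
  proof -
    have "\<sigma> i * f x \<ge> \<sigma> i * f (p i) + m / 4 * (norm (p i - x))\<^sup>2"
      by (rule midpoint_convex_growth[where B = "B i", OF B(2) B(1) that(2) _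
            has_hessian_midpoint[OF has_hessian_cmult[OF f] B(2) B(1) that(2) HB[OF that(1)]]])
        (use that fB f0 in auto)
    then show ?thesis using f0[OF that(1)] by simp
  qed
  have "\<forall>i j. \<exists>k. j < n \<longrightarrow> (\<forall>x\<in>B i. \<forall>v. norm v = 1 \<longrightarrow> \<bar>Hg j x v\<bar> \<le> k)"
    unfolding B_def using has_hessian_bounded[OF g] by blast
  then obtain K where K: "\<And>i j x v. j < n \<Longrightarrow> x \<in> B i \<Longrightarrow> norm v = 1 \<Longrightarrow> \<bar>Hg j x v\<bar> \<le> K i j"
    by metis
  define L where "L = (\<Sum>i<n. \<Sum>j<n. \<bar>K i j\<bar>) + 1"
  have L: "L > 0" "\<And>i. i < n \<Longrightarrow> (\<Sum>j<n. \<bar>K i j\<bar>) \<le> L"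
  proof -
    show "L > 0" unfolding L_def by (intro add_nonneg_pos sum_nonneg) auto
    show "(\<Sum>j<n. \<bar>K i j\<bar>) \<le> L" if "i < n" for i
      using member_le_sum[of i "{..<n}" "\<lambda>i. \<Sum>j<n. \<bar>K i j\<bar>"] that by (auto simp: L_def sum_nonneg)
  qed
  \<comment> \<open>Since the coefficients will satisfy \<open>\<bar>c j\<bar> \<le> 2\<close>, the
    first bound limits the change of the Hessian to \<open>m / 2\<close>. The second gives
    \<open>6 * \<epsilon> < m / 4 * r^2\<close>, as 6/25 < 1/4: on the boundary sphere
    \<open>\<sigma> i * f\<close> then exceeds anything that the perturbation could lower to
    \<open>\<epsilon>\<close>.\<close>
  define \<epsilon> where "\<epsilon> = min (m / (4 * L)) (m * r\<^sup>2 / 25)"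
  have \<epsilon>: "\<epsilon> > 0" "2 * \<epsilon> * L \<le> m / 2" "6 * \<epsilon> < m / 4 * r\<^sup>2"
  proof -
    show "\<epsilon> > 0" using m r0 L by (simp add: \<epsilon>_def)
    have "\<epsilon> \<le> m / (4 * L)" by (simp add: \<epsilon>_def)
    then show "2 * \<epsilon> * L \<le> m / 2" using L(1) by (simp add: field_simps)
    have "\<epsilon> \<le> m * r\<^sup>2 / 25" by (simp add: \<epsilon>_def)
    moreover have "m * r\<^sup>2 > 0" using m r0 by simp
    ultimately show "6 * \<epsilon> < m / 4 * r\<^sup>2" by (simp add: field_simps)
  qed
  define h where "h = (\<lambda>c x. f x + (\<Sum>j<n. (\<epsilon> * c j) * g j x))"
  have conth: "continuous_on A (h c)" for A c
    unfolding h_def by (intro continuous_intros continuous_on_subset[OF cont(1)] continuous_on_subset[OF cont(2)]) auto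
  define V where "V = (\<lambda>c i. Inf ((\<lambda>x. \<sigma> i * h c x) ` B i))"
  have Vmin: "\<exists>x\<in>B i. V c i = \<sigma> i * h c x \<and> (\<forall>y\<in>B i. V c i \<le> \<sigma> i * h c y)" for c i
  proof -
    have "continuous_on (B i) (\<lambda>x. \<sigma> i * h c x)" by (intro continuous_intros conth)
    from continuous_attains_inf[OF B(3,4) this]
    obtain x where x: "x \<in> B i" "\<forall>y\<in>B i. \<sigma> i * h c x \<le> \<sigma> i * h c y" by blast
    then have "V c i = \<sigma> i * h c x" unfolding V_def by (intro cInf_eq_minimum) auto
    then show ?thesis using x by metis
  qed
  have bdd: "bdd_below ((\<lambda>x. \<sigma> i * h c x) ` B i)" for c i
    using Vmin[of i c] by (auto intro!: bdd_belowI)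
  have near: "\<bar>(\<Sum>j<n. a j * g j x) - a i\<bar> \<le> N / 2"
    if "i < n" "x \<in> B i" "\<And>j. j < n \<Longrightarrow> \<bar>a j\<bar> \<le> N" for a N i x
  proof -
    have N: "N \<ge> 0" using that(3)[OF that(1)] by simp
    have "(\<Sum>j<n. a j * g j x) - a i = (\<Sum>j<n. a j * g j x) - (\<Sum>j<n. a j * (if i = j then 1 else 0))"
      using that(1) by (simp add: if_distrib sum.delta cong: if_cong)
    also have "\<dots> = (\<Sum>j<n. a j * (g j x - (if i = j then 1 else 0)))"
      by (simp add: sum_subtractf right_diff_distrib)
    also have "\<bar>\<dots>\<bar> \<le> (\<Sum>j<n. \<bar>a j * (g j x - (if i = j then 1 else 0))\<bar>)" by (rule sum_abs)
    also have "\<dots> \<le> (\<Sum>j<n. N * \<eta>)"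
      unfolding abs_mult
    proof (rule sum_mono)
      fix j assume "j \<in> {..<n}"
      then have "j < n" by simp
      from that(3)[OF this] gB[OF that(1) this that(2)] N
      show "\<bar>a j\<bar> * \<bar>g j x - (if i = j then 1 else 0)\<bar> \<le> N * \<eta>" by (intro mult_mono) auto
    qed
    also have "\<dots> = N * (real n * \<eta>)" by simp
    also have "\<dots> \<le> N * (1/2)" using \<eta>(2) N by (rule mult_left_mono)
    finally show ?thesis by simp
  qed
  \<comment> \<open>Its fixed points are the \<open>c\<close> with
    \<open>V c i = \<epsilon>\<close>. Up to an error with Lipschitz constant 1/2,
    \<open>V c i / \<epsilon>\<close> varies like \<open>\<sigma> i * c i\<close>; multiplied by
    \<open>\<sigma> i\<close> it cancels the variation of the leading \<open>c i\<close>, and only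
    the error remains.\<close>
  define T where "T = (\<lambda>c i. c i - \<sigma> i * (V c i / \<epsilon> - 1))"
  have half: "V c i - V c' i \<le> \<epsilon> * (\<sigma> i * (c i - c' i) + N / 2)"
    if i: "i < n" and N: "\<And>j. j < n \<Longrightarrow> \<bar>c j - c' j\<bar> \<le> N" for c c' N i
  proof -
    have "\<sigma> i * h c x \<le> \<sigma> i * h c' x + \<epsilon> * (\<sigma> i * (c i - c' i) + N / 2)" if x: "x \<in> B i" for x
    proof -
      have "h c x - h c' x = \<epsilon> * (\<Sum>j<n. (c j - c' j) * g j x)"
        by (simp add: h_def sum_distrib_left algebra_simps sum_subtractf)
      moreover have "\<sigma> i * (\<Sum>j<n. (c j - c' j) * g j x) \<le> \<sigma> i * (c i - c' i) + N / 2"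
      proof -
        have "\<bar>(\<Sum>j<n. (c j - c' j) * g j x) - (c i - c' i)\<bar> \<le> N / 2" by (rule near[OF i x]) (rule N)
        from signed_le[OF \<sigma>[OF i] this] show ?thesis .
      qed
      then have "\<epsilon> * (\<sigma> i * (\<Sum>j<n. (c j - c' j) * g j x)) \<le> \<epsilon> * (\<sigma> i * (c i - c' i) + N / 2)"
        using \<epsilon>(1) by simp
      ultimately show ?thesis by (simp add: algebra_simps)
    qed
    from Inf_image_le_shift[OF B(4) bdd this] show ?thesis unfolding V_def by simp
  qed
  have Tc: "\<bar>T c i - T c' i\<bar> \<le> N / 2"
    if i: "i < n" and N: "\<And>j. j < n \<Longrightarrow> \<bar>c j - c' j\<bar> \<le> N" for c c' N i
  proof -
    have N': "\<bar>c' j - c j\<bar> \<le> N" if "j < n" for j using N[OF that] by (simp add: abs_minus_commute)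
    have "(V c i - V c' i) / \<epsilon> \<le> \<sigma> i * (c i - c' i) + N / 2"
      using half[of i c c' N, OF i] N \<epsilon>(1) by (simp add: field_simps)
    moreover have "(V c' i - V c i) / \<epsilon> \<le> \<sigma> i * (c' i - c i) + N / 2"
      using half[of i c' c N, OF i] N' \<epsilon>(1) by (simp add: field_simps)
    ultimately show ?thesis
      using \<sigma>[OF i] unfolding T_def diff_divide_distrib by (elim disjE; simp only:) argo+
  qed
  from finite_contraction_fixpoint[of n T, OF Tc]
  obtain c where c: "\<And>i. i < n \<Longrightarrow> T c i = c i" by blast
  have V1: "V c i = \<epsilon>" if "i < n" for i
    using c[OF that] \<sigma>[OF that] \<epsilon>(1) by (auto simp: T_def field_simps)
  have V0: "V (\<lambda>_. 0) i = 0" if "i < n" for i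
  proof -
    obtain x where "x \<in> B i" "V (\<lambda>_. 0) i = \<sigma> i * h (\<lambda>_. 0) x" "\<forall>y\<in>B i. V (\<lambda>_. 0) i \<le> \<sigma> i * h (\<lambda>_. 0) y"
      using Vmin by blast
    then show ?thesis using fB[OF that, of x] f0[OF that] B(1)[of i] by (force simp: h_def)
  qed
  \<comment> \<open>The contraction maps 0 to \<open>\<sigma>\<close>. At an index where
    \<open>\<bar>c k\<bar>\<close> attains the maximum \<open>N\<close> this gives
    \<open>N \<le> 1 + N / 2\<close>.\<close>
  have c2: "\<bar>c i\<bar> \<le> 2" if i: "i < n" for i
  proof -
    define N where "N = Max ((\<lambda>j. \<bar>c j\<bar>) ` {..<n})"
    have N: "\<bar>c j - 0\<bar> \<le> N" if "j < n" for j unfolding N_def using that by (auto intro!: Max_ge)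
    have "N \<in> (\<lambda>j. \<bar>c j\<bar>) ` {..<n}" unfolding N_def using i by (intro Max_in) auto
    then obtain k where k: "k < n" "\<bar>c k\<bar> = N" by auto
    have "\<bar>T c k - T (\<lambda>_. 0) k\<bar> \<le> N / 2" using N by (intro Tc k(1)) auto
    moreover have "T (\<lambda>_. 0) k = \<sigma> k" using V0[OF k(1)] by (simp add: T_def)
    ultimately have "\<bar>c k - \<sigma> k\<bar> \<le> N / 2" by (simp only: c[OF k(1)])
    then have "N \<le> 2" using k(2) \<sigma>[OF k(1)] by (elim disjE; simp only:)
    then show ?thesis using N[OF i] by simp
  qed
  have hf: "\<bar>h c x - f x\<bar> \<le> 3 * \<epsilon>" if "i < n" "x \<in> B i" for i x
  proof -
    have "h c x - f x = \<epsilon> * (\<Sum>j<n. c j * g j x)" by (simp add: h_def sum_distrib_left mult.assoc)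
    moreover have "\<bar>\<Sum>j<n. c j * g j x\<bar> \<le> 3"
    proof -
      have "\<bar>(\<Sum>j<n. c j * g j x) - c i\<bar> \<le> 2 / 2" by (rule near[OF that]) (rule c2)
      then show ?thesis using c2[OF that(1)] by argo
    qed
    ultimately show ?thesis using \<epsilon>(1) by (simp add: abs_mult)
  qed
  have hes: "has_hessian (\<lambda>x. \<sigma> i * h c x) (\<lambda>x v. \<sigma> i * (Hf x v + (\<Sum>j<n. (\<epsilon> * c j) * Hg j x v)))" for i
    unfolding h_def
    by (intro has_hessian_cmult has_hessian_add[OF f] has_hessian_sum has_hessian_cmult g) auto
  have Hh: "\<sigma> i * (Hf x v + (\<Sum>j<n. (\<epsilon> * c j) * Hg j x v)) \<ge> m / 2" if i: "i < n" and x: "x \<in> B i" and v: "norm v = 1" for i x v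
  proof -
    have "\<bar>\<Sum>j<n. (\<epsilon> * c j) * Hg j x v\<bar> \<le> (\<Sum>j<n. \<bar>(\<epsilon> * c j) * Hg j x v\<bar>)" by (rule sum_abs)
    also have "\<dots> \<le> (\<Sum>j<n. (\<epsilon> * 2) * \<bar>K i j\<bar>)"
    proof (rule sum_mono)
      fix j assume "j \<in> {..<n}"
      then have "\<bar>c j\<bar> \<le> 2" "\<bar>Hg j x v\<bar> \<le> \<bar>K i j\<bar>" using c2[of j] K[OF _ x v, of j] by auto
      then show "\<bar>(\<epsilon> * c j) * Hg j x v\<bar> \<le> (\<epsilon> * 2) * \<bar>K i j\<bar>"
        using \<epsilon>(1) unfolding abs_mult by (intro mult_mono) auto
    qed
    also have "\<dots> = (\<epsilon> * 2) * (\<Sum>j<n. \<bar>K i j\<bar>)" by (simp add: sum_distrib_left)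
    also have "\<dots> \<le> (\<epsilon> * 2) * L" using L(2)[OF i] \<epsilon>(1) by (intro mult_left_mono) auto
    finally have "\<bar>\<Sum>j<n. (\<epsilon> * c j) * Hg j x v\<bar> \<le> m / 2" using \<epsilon>(2) by (simp add: mult_ac)
    moreover have "\<sigma> i * Hf x v \<ge> m" by (rule HB[OF i x v])
    ultimately show ?thesis using \<sigma>[OF i] by (auto simp: abs_le_iff)
  qed
  have "\<forall>i. \<exists>x. x \<in> B i \<and> V c i = \<sigma> i * h c x \<and> (\<forall>y\<in>B i. V c i \<le> \<sigma> i * h c y)"
    using Vmin by blast
  from choice[OF this] obtain x where x': "\<And>i. x i \<in> B i" "\<And>i. V c i = \<sigma> i * h c (x i)"
    "\<And>i y. y \<in> B i \<Longrightarrow> V c i \<le> \<sigma> i * h c y" by blast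
  have x: "x i \<in> B i" "\<sigma> i * h c (x i) = \<epsilon>" "y \<in> B i \<Longrightarrow> \<epsilon> \<le> \<sigma> i * h c y" if "i < n" for i y
    using x'(1)[of i] x'(2)[of i] x'(3)[of y i] V1[OF that] by simp_all
  have grow: "\<sigma> i * h c y \<ge> \<epsilon> + m / 8 * (norm (x i - y))\<^sup>2" if "i < n" "y \<in> B i" for i y
  proof -
    have "\<sigma> i * h c y \<ge> \<sigma> i * h c (x i) + (m / 2) / 4 * (norm (x i - y))\<^sup>2"
      by (rule midpoint_convex_growth[where B = "B i", OF B(2) x(1)[OF that(1)] that(2) _
            has_hessian_midpoint[OF hes B(2) x(1)[OF that(1)] that(2) Hh[OF that(1)]]])
        (simp_all add: x(2)[OF that(1)] x(3)[OF that(1)])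
    then show ?thesis using x(2)[OF that(1)] by simp
  qed
  \<comment> \<open>A minimizer over the closed ball is a local extremum of the function on the
    whole space only if it avoids the boundary. There \<open>\<sigma> i * f\<close> would be at
    least \<open>m / 4 * r^2\<close>, but at \<open>x i\<close> it is at most
    \<open>4 * \<epsilon>\<close>.\<close>
  have interior: "x i \<in> ball (p i) r" if i: "i < n" for i
  proof (rule ccontr)
    assume "\<not> ?thesis"
    then have "norm (p i - x i) = r" using x(1)[OF i] by (auto simp: B_def dist_norm)
    then have "\<sigma> i * f (x i) \<ge> m / 4 * r\<^sup>2" using growf[OF i x(1)[OF i]] by simp
    moreover have "\<bar>\<sigma> i * h c (x i) - \<sigma> i * f (x i)\<bar> \<le> 3 * \<epsilon>"
      using hf[OF i x(1)[OF i]] \<sigma>[OF i] by (auto simp: abs_le_iff)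
    ultimately show False using x(2)[OF i] \<epsilon> by (simp add: abs_le_iff)
  qed
  have "inj_on x {..<n}"
  proof (rule inj_onI, rule ccontr)
    fix i j assume ij: "i \<in> {..<n}" "j \<in> {..<n}" "x i = x j" "i \<noteq> j"
    then have "2 * r < dist (p i) (p j)" using r[of i] by auto
    moreover have "dist (p i) (p j) \<le> dist (p i) (x i) + dist (x i) (p j)" by (rule dist_triangle)
    ultimately show False using interior[of i] interior[of j] ij by (auto simp: dist_commute)
  qed
  moreover have "h c (x i) = \<epsilon> * \<sigma> i" if "i < n" for i using x(2)[OF that] \<sigma>[OF that] by auto
  moreover have "\<forall>\<^sub>F y in nhds (x i). \<sigma> i * h c y \<ge> \<epsilon> + m / 8 * (norm (x i - y))\<^sup>2" if "i < n" for i
  proof -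
    have "\<forall>\<^sub>F y in nhds (x i). y \<in> ball (p i) r"
      using interior[OF that] by (intro eventually_nhds_in_open) auto
    then show ?thesis by (rule eventually_mono) (rule grow[OF that], simp add: B_def)
  qed
  ultimately show ?thesis
    unfolding h_def using \<epsilon>(1) m(1)
    by (intro exI[of _ "\<epsilon>"] exI[of _ "\<lambda>j. \<epsilon> * c j"] exI[of _ x] exI[of _ "m / 8"]) simp
qed

section \<open>The rational curve and its solitary nodes\<close>

lemma poly_eq_sum_le:
  fixes p :: "'a::comm_ring_1 poly"
  assumes "degree p \<le> n"
  shows "poly p x = (\<Sum>i\<le>n. coeff p i * x ^ i)"
  unfolding poly_altdef by (rule sum.mono_neutral_left) (use assms in \<open>auto simp: coeff_eq_0\<close>)

text \<open>Give the inner variable weight 1 and the outer one weight \<open>k\<close>; every factor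
  then has weighted degree at most \<open>k\<close>. The zero coefficient is a separate case because
  its degree is 0, which breaks the bound when \<open>j > card A\<close>.\<close>

lemma coeff_prod_linear_degree:
  fixes a :: "'b \<Rightarrow> complex poly"
  assumes "finite A" "\<And>z. z \<in> A \<Longrightarrow> degree (a z) \<le> k"
  shows "coeff (\<Prod>z\<in>A. [:a z, -1:]) j = 0 \<or> degree (coeff (\<Prod>z\<in>A. [:a z, -1:]) j) + k * j \<le> k * card A"
  using assms
proof (induction A arbitrary: j)
  case empty
  then show ?case by (cases j) auto
next
  case (insert z A)
  define Q where "Q = (\<Prod>z\<in>A. [:a z, -1:])"
  have IH: "coeff Q j = 0 \<or> degree (coeff Q j) + k * j \<le> k * card A" for j
    unfolding Q_def using insert by auto
  have az: "degree (a z) \<le> k" using insert by auto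
  have c: "coeff (\<Prod>z\<in>insert z A. [:a z, -1:]) j = a z * coeff Q j - (case j of 0 \<Rightarrow> 0 | Suc j' \<Rightarrow> coeff Q j')"
    using insert.hyps by (simp add: Q_def[symmetric] coeff_pCons split: nat.split)
  have 1: "a z * coeff Q j = 0 \<or> degree (a z * coeff Q j) + k * j \<le> k * Suc (card A)"
    using IH[of j] degree_mult_le[of "a z" "coeff Q j"] az by auto
  have 2: "(case j of 0 \<Rightarrow> 0 | Suc j' \<Rightarrow> coeff Q j') = 0 \<or>
      degree (case j of 0 \<Rightarrow> 0 | Suc j' \<Rightarrow> coeff Q j') + k * j \<le> k * Suc (card A)"
    using IH[of "j - 1"] by (auto split: nat.split)
  have card: "card (insert z A) = Suc (card A)" using insert.hyps by simp
  show ?case unfolding c card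
    using 1 2 degree_diff_le_max[of "a z * coeff Q j" "case j of 0 \<Rightarrow> 0 | Suc j' \<Rightarrow> coeff Q j'"]
    by (auto simp: max_def split: if_splits)
qed

lemma polys_eq_on_all:
  fixes a b :: "nat \<Rightarrow> 'a::{comm_ring_1,ring_no_zero_divisors,ring_char_0}"
  assumes "\<And>x. (\<Sum>j\<le>n. a j * x ^ j) = (\<Sum>j\<le>n. b j * x ^ j)" "j \<le> n"
  shows "a j = b j"
proof -
  have "poly (\<Sum>j\<le>n. monom (a j) j) = poly (\<Sum>j\<le>n. monom (b j) j)"
    using assms(1) by (auto simp: poly_sum poly_monom)
  then have "(\<Sum>j\<le>n. monom (a j) j) = (\<Sum>j\<le>n. monom (b j) j)" by (simp only: poly_eq_poly_eq_iff)
  then have "coeff (\<Sum>j\<le>n. monom (a j) j) j = coeff (\<Sum>j\<le>n. monom (b j) j) j" by simp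
  then show ?thesis using assms(2) by (simp add: coeff_sum)
qed

text \<open>Replacing \<open>t\<close> by \<open>w * t\<close>, with \<open>w\<close> a primitive
  \<open>d\<close>-th root of unity, multiplies the coefficient of \<open>t^m\<close> by
  \<open>w^m\<close>, so only exponents divisible by \<open>d\<close> survive.\<close>

lemma poly_in_power:
  fixes q :: "complex poly"
  assumes d: "d \<ge> 1" and inv: "\<And>w t. w ^ d = 1 \<Longrightarrow> poly q (w * t) = poly q t" and deg: "degree q \<le> d * n"
  shows "poly q t = (\<Sum>i\<le>n. coeff q (d * i) * (t ^ d) ^ i)"
proof -
  define w where "w = exp (2 * of_real pi * \<i> * of_nat 1 / of_nat d)"
  have wd: "w ^ d = 1" unfolding w_def by (rule complex_root_unity) (use d in auto)
  have "pcompose q [:0, w:] = q"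
    by (subst poly_eq_poly_eq_iff[symmetric]) (simp add: poly_pcompose mult.commute[of _ w] inv[OF wd] fun_eq_iff)
  then have "w ^ m * coeff q m = coeff q m" for m by (metis coeff_pcompose_linear)
  moreover have "w ^ m \<noteq> 1" if "\<not> d dvd m" for m
    using that complex_root_unity_eq_1[OF d, of m] by (simp add: w_def exp_of_nat_mult[symmetric] mult_ac)
  ultimately have z: "coeff q m = 0" if "\<not> d dvd m" for m
    using that by (metis mult_cancel_right1)
  have "poly q t = (\<Sum>m\<le>d * n. coeff q m * t ^ m)"
    by (rule poly_eq_sum_le[OF deg])
  also have "\<dots> = (\<Sum>m\<in>(\<lambda>i. d * i) ` {..n}. coeff q m * t ^ m)"
  proof (rule sum.mono_neutral_right)
    show "\<forall>m\<in>{..d * n} - (\<lambda>i. d * i) ` {..n}. coeff q m * t ^ m = 0"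
    proof
      fix m assume m: "m \<in> {..d * n} - (\<lambda>i. d * i) ` {..n}"
      have "\<not> d dvd m"
      proof
        assume "d dvd m"
        then obtain k where k: "m = d * k" by (auto elim: dvdE)
        with m d have "k \<le> n" by auto
        with m k show False by auto
      qed
      then show "coeff q m * t ^ m = 0" by (simp add: z)
    qed
  qed auto
  also have "\<dots> = (\<Sum>i\<le>n. coeff q (d * i) * (t ^ d) ^ i)"
    using d by (subst sum.reindex) (auto simp: inj_on_def power_mult)
  finally show ?thesis .
qed

text \<open>The product is invariant under multiplication of \<open>t\<close> by \<open>d\<close>-th roots of unity, hence a polynomial
  in \<open>t ^ d\<close>.\<close>

lemma fermat_curve_polynomial:
  assumes d: "d \<ge> 1"
  obtains c :: "nat \<Rightarrow> nat \<Rightarrow> complex" where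
    "\<And>i j. i + j > d \<Longrightarrow> c i j = 0"
    "\<And>t Y. (\<Prod>z | z ^ d = 1. (1 - z * t) ^ d - Y) = (\<Sum>i\<le>d. \<Sum>j\<le>d. c i j * (t ^ d) ^ i * Y ^ j)"
proof -
  define S where "S = {z::complex. z ^ d = 1}"
  have S: "finite S" "card S = d" using d by (auto simp: S_def card_complex_roots_unity finite_roots_unity)
  define P where "P = (\<Prod>z\<in>S. [:[:1, -z:] ^ d, -1:])"
  have degP: "degree P \<le> d"
  proof -
    have "degree P \<le> (\<Sum>z\<in>S. degree [:[:1, -z:] ^ d, -1:])" unfolding P_def by (rule degree_prod_sum_le[OF S(1), unfolded o_def])
    also have "\<dots> \<le> (\<Sum>z\<in>S. 1)" by (intro sum_mono) auto
    finally show ?thesis using S by simp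
  qed
  have ev: "(\<Prod>z\<in>S. (1 - z * t) ^ d - Y) = (\<Sum>j\<le>d. poly (coeff P j) t * Y ^ j)" for t Y
  proof -
    have "(\<Prod>z\<in>S. (1 - z * t) ^ d - Y) = poly (poly P [:Y:]) t"
      by (simp add: P_def poly_prod poly_power mult.commute)
    also have "poly P [:Y:] = (\<Sum>j\<le>d. coeff P j * [:Y:] ^ j)" by (rule poly_eq_sum_le[OF degP])
    finally show ?thesis by (simp add: poly_sum poly_power)
  qed
  \<comment> \<open>This is what bounds the total degree: a polynomial in \<open>t^d\<close> of
    degree at most \<open>d * (d - j)\<close> in \<open>t\<close> has degree at most
    \<open>d - j\<close> in \<open>t^d\<close>.\<close>
  have degc: "degree (coeff P j) \<le> d * (d - j)" if "j \<le> d" for j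
  proof -
    have "degree ([:1, -z:] ^ d) \<le> d" for z :: complex
      using degree_power_le[of "[:1, -z:]" d] by (rule order_trans) (simp add: degree_pCons_le)
    from coeff_prod_linear_degree[OF S(1), of "\<lambda>z. [:1, -z:] ^ d" d j] this that show ?thesis
      unfolding P_def[symmetric] S(2) by (auto simp: diff_mult_distrib2)
  qed
  have inv: "poly (coeff P j) (w * t) = poly (coeff P j) t" if w: "w ^ d = 1" and "j \<le> d" for w t j
  proof (rule polys_eq_on_all[OF _ that(2)])
    fix Y
    have "(\<Prod>z\<in>S. (1 - z * (w * t)) ^ d - Y) = (\<Prod>z\<in>S. (1 - z * t) ^ d - Y)"
    proof (rule prod.reindex_bij_witness[where i = "\<lambda>z. z / w" and j = "\<lambda>z. z * w"])
      show "z / w \<in> S" if "z \<in> S" for z using that w by (simp add: S_def power_divide)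
    qed (use w d in \<open>auto simp: S_def power_mult_distrib power_0_left mult_ac\<close>)
    then show "(\<Sum>j\<le>d. poly (coeff P j) (w * t) * Y ^ j) = (\<Sum>j\<le>d. poly (coeff P j) t * Y ^ j)"
      by (simp only: ev)
  qed
  \<comment> \<open>The cut-off builds the degree condition into the coefficients; by
    \<open>degc\<close> it discards only zeros.\<close>
  define c where "c = (\<lambda>i j. if i + j > d then 0 else coeff (coeff P j) (d * i))"
  have "(\<Prod>z | z ^ d = 1. (1 - z * t) ^ d - Y) = (\<Sum>i\<le>d. \<Sum>j\<le>d. c i j * (t ^ d) ^ i * Y ^ j)" for t Y
  proof -
    have "poly (coeff P j) t = (\<Sum>i\<le>d. c i j * (t ^ d) ^ i)" if j: "j \<le> d" for j
    proof -
      have "poly (coeff P j) t = (\<Sum>i\<le>d - j. coeff (coeff P j) (d * i) * (t ^ d) ^ i)"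
        by (rule poly_in_power[OF d inv degc]) (use j in auto)
      also have "\<dots> = (\<Sum>i\<le>d - j. c i j * (t ^ d) ^ i)" using j by (intro sum.cong) (auto simp: c_def)
      also have "\<dots> = (\<Sum>i\<le>d. c i j * (t ^ d) ^ i)" by (intro sum.mono_neutral_left) (auto simp: c_def)
      finally show ?thesis .
    qed
    then have "(\<Prod>z\<in>S. (1 - z * t) ^ d - Y) = (\<Sum>j\<le>d. (\<Sum>i\<le>d. c i j * (t ^ d) ^ i) * Y ^ j)"
      unfolding ev by (intro sum.cong) auto
    also have "\<dots> = (\<Sum>i\<le>d. \<Sum>j\<le>d. c i j * (t ^ d) ^ i * Y ^ j)"
      by (subst sum.swap) (simp add: sum_distrib_right)
    finally show ?thesis by (simp add: S_def)
  qed
  then show ?thesis by (intro that[of c]) (auto simp: c_def)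
qed

definition plane_poly :: "nat \<Rightarrow> (real \<times> real \<Rightarrow> real) \<Rightarrow> bool" where
  "plane_poly d h \<longleftrightarrow> (\<exists>c. (\<forall>i j. i + j > d \<longrightarrow> c i j = 0) \<and>
     (\<forall>x y. h (x, y) = (\<Sum>i\<le>d. \<Sum>j\<le>d. c i j * x ^ i * y ^ j)))"

text \<open>At real \<open>X\<close> and \<open>Y\<close> every monomial is real, so taking the real
  part of the product amounts to taking the real parts of the coefficients.\<close>

lemma fermat_curve_real:
  assumes d: "d \<ge> 1"
  obtains f where "plane_poly d f"
    "\<And>t X Y. t ^ d = of_real X \<Longrightarrow> f (X, Y) = Re (\<Prod>z | z ^ d = 1. (1 - z * t) ^ d - of_real Y)"
proof -
  obtain c :: "nat \<Rightarrow> nat \<Rightarrow> complex" where c: "\<And>i j. i + j > d \<Longrightarrow> c i j = 0"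
    "\<And>t Y. (\<Prod>z | z ^ d = 1. (1 - z * t) ^ d - Y) = (\<Sum>i\<le>d. \<Sum>j\<le>d. c i j * (t ^ d) ^ i * Y ^ j)"
    by (rule fermat_curve_polynomial[OF d]) (rule that)
  define f where "f = (\<lambda>p::real \<times> real. \<Sum>i\<le>d. \<Sum>j\<le>d. Re (c i j) * fst p ^ i * snd p ^ j)"
  have "plane_poly d f"
    unfolding plane_poly_def f_def using c(1) by (intro exI[of _ "\<lambda>i j. Re (c i j)"]) auto
  moreover have "f (X, Y) = Re (\<Prod>z | z ^ d = 1. (1 - z * t) ^ d - of_real Y)" if "t ^ d = of_real X" for t X Y
  proof -
    have "Re (c i j * of_real X ^ i * of_real Y ^ j) = Re (c i j) * X ^ i * Y ^ j" for i j
    proof -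
      have "c i j * of_real X ^ i * of_real Y ^ j = c i j * of_real (X ^ i * Y ^ j)" by simp
      then show ?thesis by (simp only: times_complex.sel Re_complex_of_real Im_complex_of_real)
    qed
    then show ?thesis unfolding c(2) that f_def by simp
  qed
  ultimately show ?thesis by (rule that)
qed

text \<open>The factors at \<open>w\<close> and \<open>cnj w\<close> multiply to a squared modulus,
  so the sign of the product is decided by the real \<open>w\<close> alone.\<close>

lemma prod_conjugate_pairs:
  fixes \<phi> :: "complex \<Rightarrow> complex"
  assumes W: "finite W" "\<And>w. w \<in> W \<Longrightarrow> cnj w \<in> W" and \<phi>: "\<And>w. w \<in> W \<Longrightarrow> \<phi> (cnj w) = cnj (\<phi> w)"
  shows "(\<Prod>w\<in>W. \<phi> w) = of_real ((cmod (\<Prod>w\<in>{w\<in>W. Im w > 0}. \<phi> w))\<^sup>2) * (\<Prod>w\<in>{w\<in>W. Im w = 0}. \<phi> w)"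
proof -
  let ?P = "{w\<in>W. Im w > 0}" and ?N = "{w\<in>W. Im w < 0}" and ?Z = "{w\<in>W. Im w = 0}"
  have W': "W = ?P \<union> (?N \<union> ?Z)" by auto
  have "(\<Prod>w\<in>W. \<phi> w) = (\<Prod>w\<in>?P. \<phi> w) * ((\<Prod>w\<in>?N. \<phi> w) * (\<Prod>w\<in>?Z. \<phi> w))"
    by (subst W', subst prod.union_disjoint, (use W in auto)[3], subst prod.union_disjoint) (use W in auto)
  also have "(\<Prod>w\<in>?N. \<phi> w) = (\<Prod>w\<in>?P. cnj (\<phi> w))"
    by (rule prod.reindex_bij_witness[where i = cnj and j = cnj])
       (use W \<phi> in \<open>auto\<close>)
  also have "\<dots> = cnj (\<Prod>w\<in>?P. \<phi> w)" by simp
  finally show ?thesis by (simp only: complex_norm_square mult.assoc)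
qed

text \<open>Circles centred at 0 and 1 meet only in a pair of conjugate points. Hence the parameters
  over a node are just \<open>t\<close> and \<open>cnj t\<close>.\<close>

lemma same_modulus_pair:
  assumes "cmod w = cmod t" "cmod (1 - w) = cmod (1 - t)"
  shows "w = t \<or> w = cnj t"
proof -
  have "(Re w)\<^sup>2 + (Im w)\<^sup>2 = (Re t)\<^sup>2 + (Im t)\<^sup>2" "(1 - Re w)\<^sup>2 + (Im w)\<^sup>2 = (1 - Re t)\<^sup>2 + (Im t)\<^sup>2"
    using assms by (simp_all add: cmod_def)
  then have "Re w = Re t" and "(Im w)\<^sup>2 = (Im t)\<^sup>2" by (simp_all add: power2_eq_square algebra_simps)
  then show ?thesis by (auto simp: complex_eq_iff power2_eq_iff)
qed

text \<open>\<open>X = X0 r^d\<close> makes all \<open>d\<close>-th roots of \<open>X\<close> linear in \<open>r\<close>. The factors of the conjugate roots \<open>r t\<close> and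
  \<open>r (cnj t)\<close> vanish at the node; \<open>G\<close> collects the others, and its sign is that of the factors of the
  real roots.\<close>

lemma fermat_node_factorization:
  fixes f :: "real \<times> real \<Rightarrow> real"
  assumes d: "d \<ge> 1"
    and f: "\<And>t X Y. t ^ d = of_real X \<Longrightarrow> f (X, Y) = Re (\<Prod>z | z ^ d = 1. (1 - z * t) ^ d - of_real Y)"
    and t: "t ^ d = of_real X0" "(1 - t) ^ d = of_real Y0" "Im t > 0"
  obtains G :: "real \<Rightarrow> real \<Rightarrow> real" where
    "\<And>r Y. r > 0 \<Longrightarrow> f (X0 * r ^ d, Y) = (cmod ((1 - of_real r * t) ^ d - of_real Y))\<^sup>2 * G r Y"
    "continuous_on UNIV (\<lambda>x. G (fst x) (snd x))" "G 1 Y0 \<noteq> 0"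
    "even d \<Longrightarrow> X0 < 0 \<or> Y0 < 0 \<Longrightarrow> G 1 Y0 > 0"
proof -
  define W where "W = {w::complex. w ^ d = of_real X0}"
  have t0: "t \<noteq> 0" using t(3) by auto
  have "X0 \<noteq> 0" using t t0 by auto
  then have W: "finite W" "t \<in> W" "\<And>w. w \<in> W \<Longrightarrow> cnj w \<in> W"
    using d t finite_nth_roots[of d "of_real X0"] by (auto simp: W_def simp flip: complex_cnj_power)
  define P where "P = {w\<in>W. Im w > 0}"
  define Z where "Z = {w\<in>W. Im w = 0}"
  define G where "G = (\<lambda>r Y::real. (cmod (\<Prod>w\<in>P - {t}. (1 - of_real r * w) ^ d - of_real Y))\<^sup>2 *
      (\<Prod>w\<in>Z. (1 - r * Re w) ^ d - Y))"
  have P: "finite P" "t \<in> P" and Z: "finite Z" using W t by (auto simp: P_def Z_def)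
  have "f (X0 * r ^ d, Y) = (cmod ((1 - of_real r * t) ^ d - of_real Y))\<^sup>2 * G r Y" if "r > 0" for r Y
  proof -
    define \<phi> where "\<phi> = (\<lambda>w::complex. (1 - of_real r * w) ^ d - of_real Y)"
    have "(of_real r * t) ^ d = of_real (X0 * r ^ d)" by (simp add: power_mult_distrib t)
    from f[OF this] have "f (X0 * r ^ d, Y) = Re (\<Prod>z | z ^ d = 1. \<phi> (z * t))"
      by (simp add: \<phi>_def mult_ac)
    also have "(\<Prod>z | z ^ d = 1. \<phi> (z * t)) = (\<Prod>w\<in>W. \<phi> w)"
      by (rule prod.reindex_bij_witness[where i = "\<lambda>w. w / t" and j = "\<lambda>z. z * t"])
        (use t t0 \<open>X0 \<noteq> 0\<close> in \<open>auto simp: W_def power_divide power_mult_distrib\<close>)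
    also have "\<dots> = of_real ((cmod (\<Prod>w\<in>P. \<phi> w))\<^sup>2) * (\<Prod>w\<in>Z. \<phi> w)"
      unfolding P_def Z_def by (rule prod_conjugate_pairs) (use W in \<open>auto simp: \<phi>_def\<close>)
    also have "(\<Prod>w\<in>Z. \<phi> w) = (\<Prod>w\<in>Z. of_real ((1 - r * Re w) ^ d - Y))"
    proof (intro prod.cong refl)
      fix w assume "w \<in> Z"
      then obtain x where "w = of_real x" by (auto simp: Z_def complex_eq_iff intro!: that[of "Re w"])
      then show "\<phi> w = of_real ((1 - r * Re w) ^ d - Y)" by (simp add: \<phi>_def)
    qed
    also have "\<dots> = of_real (\<Prod>w\<in>Z. (1 - r * Re w) ^ d - Y)" by (simp only: of_real_prod)
    finally have "f (X0 * r ^ d, Y) = (cmod (\<Prod>w\<in>P. \<phi> w))\<^sup>2 * (\<Prod>w\<in>Z. (1 - r * Re w) ^ d - Y)"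
      by (simp only: of_real_mult[symmetric] Re_complex_of_real)
    also have "(\<Prod>w\<in>P. \<phi> w) = \<phi> t * (\<Prod>w\<in>P - {t}. \<phi> w)" by (rule prod.remove[OF P])
    finally show ?thesis by (simp add: G_def \<phi>_def norm_mult power_mult_distrib)
  qed
  moreover have "continuous_on UNIV (\<lambda>x. G (fst x) (snd x))"
    unfolding G_def by (intro continuous_intros)
  moreover have "G 1 Y0 \<noteq> 0"
  proof -
    \<comment> \<open>A further vanishing factor would belong to a root with the same distances to 0
      and 1 as \<open>t\<close>, hence to \<open>t\<close> itself or to \<open>cnj t\<close>, which
      lies in the lower half-plane.\<close>
    have nz: "(1 - w) ^ d \<noteq> of_real Y0" if w: "w \<in> W" "Im w \<ge> 0" "w \<noteq> t" for w
    proof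
      assume "(1 - w) ^ d = of_real Y0"
      then have "cmod ((1 - w) ^ d) = cmod ((1 - t) ^ d)" by (simp only: t)
      then have "cmod (1 - w) = cmod (1 - t)"
        using d power_eq_imp_eq_base[of "cmod (1 - w)" d "cmod (1 - t)"] by (simp add: norm_power)
      moreover have "cmod (w ^ d) = cmod (t ^ d)" using w(1) by (simp only: W_def mem_Collect_eq t)
      then have "cmod w = cmod t"
        using d power_eq_imp_eq_base[of "cmod w" d "cmod t"] by (simp add: norm_power)
      ultimately have "w = t \<or> w = cnj t" by (intro same_modulus_pair)
      then show False using w t by auto
    qed
    have "(1 - Re w) ^ d \<noteq> Y0" if w: "w \<in> Z" for w
    proof
      assume e: "(1 - Re w) ^ d = Y0"
      obtain x where "w = of_real x" using w by (auto simp: Z_def complex_eq_iff intro!: that[of "Re w"])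
      then have "(1 - w) ^ d = of_real Y0" unfolding e[symmetric] by simp
      moreover have "w \<in> W" "Im w \<ge> 0" "w \<noteq> t" using w t(3) by (auto simp: Z_def)
      ultimately show False using nz by blast
    qed
    then have B: "(1 - 1 * Re w) ^ d - Y0 \<noteq> 0" if "w \<in> Z" for w using that by simp
    have A: "(1 - of_real 1 * w) ^ d - of_real Y0 \<noteq> 0" if "w \<in> P - {t}" for w
      using nz[of w] that by (simp add: P_def)
    have "(\<Prod>w\<in>P - {t}. (1 - of_real 1 * w) ^ d - of_real Y0) \<noteq> 0"
      by (rule ccontr) (use A P in \<open>simp only: not_not prod_zero_iff finite_Diff bex_simps, blast\<close>)
    moreover have "(\<Prod>w\<in>Z. (1 - 1 * Re w) ^ d - Y0) \<noteq> 0"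
      by (rule ccontr) (use B Z in \<open>simp only: not_not prod_zero_iff, blast\<close>)
    ultimately show ?thesis unfolding G_def by simp
  qed
  \<comment> \<open>For even \<open>d\<close> a real root forces \<open>X0 \<ge> 0\<close>. So
    either \<open>Z\<close> is empty and its product is 1, or \<open>Y0 < 0\<close> and every factor
    is an even power minus a negative number.\<close>
  moreover have "G 1 Y0 > 0" if ev: "even d" and neg: "X0 < 0 \<or> Y0 < 0"
  proof -
    have "(\<Prod>w\<in>Z. (1 - 1 * Re w) ^ d - Y0) > 0"
    proof (rule prod_pos)
      fix w assume w: "w \<in> Z"
      then obtain x where "w = of_real x" by (auto simp: Z_def complex_eq_iff intro!: that[of "Re w"])
      moreover have "w ^ d = of_real X0" using w by (simp add: Z_def W_def)
      ultimately have "x ^ d = X0" by (simp flip: of_real_power)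
      then have "X0 \<ge> 0" using zero_le_even_power[OF ev, of x] by simp
      then have "Y0 < 0" using neg by auto
      then show "(1 - 1 * Re w) ^ d - Y0 > 0" using zero_le_even_power[OF ev, of "1 - Re w"] by simp
    qed
    moreover have "(cmod (\<Prod>w\<in>P - {t}. (1 - of_real 1 * w) ^ d - of_real Y0))\<^sup>2 \<ge> 0" by simp
    ultimately have "G 1 Y0 \<ge> 0" unfolding G_def by (intro mult_nonneg_nonneg) auto
    with \<open>G 1 Y0 \<noteq> 0\<close> show ?thesis by simp
  qed
  ultimately show ?thesis by (rule that)
qed

text \<open>The factorization of \<open>f\<close> at a node involves \<open>root d\<close> and a
  squared modulus; it yields a limit along lines more easily than second derivatives. The limit
  first forces the first derivative to vanish, and l'Hopital's rule then identifies the
  second.\<close>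

lemma hessian_from_quadratic_limit:
  assumes H: "has_hessian f H" and "f p = 0"
    and L: "((\<lambda>s. f (p + s *\<^sub>R v) / s\<^sup>2) \<longlongrightarrow> L) (at 0)"
  shows "H p v = 2 * L"
proof -
  from H obtain D where D: "\<And>x v s. ((\<lambda>s. f (x + s *\<^sub>R v)) has_real_derivative D (x + s *\<^sub>R v) v) (at s)"
    "\<And>x v s. ((\<lambda>s. D (x + s *\<^sub>R v) v) has_real_derivative H (x + s *\<^sub>R v) v) (at s)"
    by (rule has_hessianE) (rule that)
  have ne: "\<forall>\<^sub>F s in at 0. s \<noteq> (0::real)" by (simp add: eventually_at_filter)
  have c0: "((\<lambda>s. f (p + s *\<^sub>R v)) \<longlongrightarrow> 0) (at 0)"
    using DERIV_isCont[OF D(1)[of p v 0]] \<open>f p = 0\<close> by (simp add: isCont_def)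
  have "((\<lambda>s. s * (f (p + s *\<^sub>R v) / s\<^sup>2)) \<longlongrightarrow> 0 * L) (at 0)"
    by (rule tendsto_mult[OF tendsto_ident_at L])
  moreover have "s * (f (p + s *\<^sub>R v) / s\<^sup>2) = f (p + s *\<^sub>R v) / s" for s
    by (simp add: power2_eq_square)
  ultimately have "((\<lambda>s. f (p + s *\<^sub>R v) / s) \<longlongrightarrow> 0) (at 0)" by simp
  moreover have "((\<lambda>s. f (p + s *\<^sub>R v) / s) \<longlongrightarrow> D p v) (at 0)"
    using D(1)[of p v 0] \<open>f p = 0\<close> by (simp add: DERIV_def)
  ultimately have D0: "D p v = 0" by (rule LIM_unique[rotated])
  have "((\<lambda>s. (D (p + s *\<^sub>R v) v / s) / 2) \<longlongrightarrow> H p v / 2) (at 0)"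
    using tendsto_divide[OF D(2)[of p v 0, unfolded DERIV_def] tendsto_const[of 2]] D0 by simp
  then have "((\<lambda>s. D (p + s *\<^sub>R v) v / (2 * s)) \<longlongrightarrow> H p v / 2) (at 0)" by (simp add: mult.commute)
  then have "((\<lambda>s. f (p + s *\<^sub>R v) / s\<^sup>2) \<longlongrightarrow> H p v / 2) (at 0)"
  proof (rule lhopital[rotated -1])
    show "((\<lambda>s. s\<^sup>2) \<longlongrightarrow> 0) (at (0::real))" by (auto intro!: tendsto_eq_intros)
    show "\<forall>\<^sub>F s in at 0. ((\<lambda>s. f (p + s *\<^sub>R v)) has_real_derivative D (p + s *\<^sub>R v) v) (at s)"
      by (intro always_eventually allI D(1))
    show "\<forall>\<^sub>F s in at 0. ((\<lambda>s. s\<^sup>2) has_real_derivative 2 * s) (at (s::real))"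
      by (intro always_eventually allI) (auto intro!: derivative_eq_intros)
    show "\<forall>\<^sub>F s in at 0. s\<^sup>2 \<noteq> (0::real)" "\<forall>\<^sub>F s in at 0. 2 * s \<noteq> (0::real)"
      using ne by simp_all
  qed (rule c0)
  from LIM_unique[OF this L] show ?thesis by simp
qed

text \<open>With \<open>X0 = t^d\<close> real, the slope \<open>dY/dX\<close> of the branch at
  \<open>t\<close> is this number times \<open>-1 / X0\<close>. If it were real, division of the
  nonzero real \<open>(1 - t)^d\<close> by it would make \<open>(1 - t) / t\<close> real, hence
  \<open>t\<close>. A non-real slope means non-real tangents, so the node is solitary.\<close>

lemma root_curve_slope_not_real:
  assumes "Im t > 0" "(1 - t) ^ d = of_real y" "d \<ge> 1"
  shows "Im (t * (1 - t) ^ (d - 1)) \<noteq> 0"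
proof
  assume "Im (t * (1 - t) ^ (d - 1)) = 0"
  then obtain k where k: "t * (1 - t) ^ (d - 1) = of_real k" by (metis complex_is_Real_iff Reals_cases)
  have "(1 - t) * (t * (1 - t) ^ (d - 1)) = t * (1 - t) ^ d" using assms(3) by (cases d) auto
  then have e: "(1 - t) * of_real k = t * of_real y" by (simp only: k assms(2))
  from arg_cong[OF e, of Im] have "Im t * k = Im t * - y" by simp
  then have "k = - y" unfolding mult_left_cancel[of "Im t", OF less_imp_neq[OF assms(1), symmetric]] .
  moreover from arg_cong[OF e, of Re] have "(1 - Re t) * k = Re t * y" by simp
  ultimately have "y = 0" by (simp add: algebra_simps)
  then show False using assms by auto
qed

text \<open>Near the node \<open>f\<close> is a squared modulus times the continuous non-vanishing
  \<open>G\<close>, so \<open>\<sigma>\<close> is the sign of \<open>G\<close>. The form is definite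
  because the derivative of the complex factor is an injective real-linear map of the plane.\<close>

lemma fermat_node:
  fixes f :: "real \<times> real \<Rightarrow> real"
  assumes d: "d \<ge> 1"
    and f: "\<And>t X Y. t ^ d = of_real X \<Longrightarrow> f (X, Y) = Re (\<Prod>z | z ^ d = 1. (1 - z * t) ^ d - of_real Y)"
    and H: "has_hessian f H"
    and t: "t ^ d = of_real X0" "(1 - t) ^ d = of_real Y0" "Im t > 0"
  obtains \<sigma> where "\<sigma> = 1 \<or> \<sigma> = (-1::real)" "f (X0, Y0) = 0"
    "\<forall>\<^sub>F x in nhds (X0, Y0). \<sigma> * f x \<ge> 0" "\<And>v. v \<noteq> 0 \<Longrightarrow> \<sigma> * H (X0, Y0) v > 0"
    "even d \<Longrightarrow> X0 < 0 \<or> Y0 < 0 \<Longrightarrow> \<sigma> = 1"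
proof -
  obtain G :: "real \<Rightarrow> real \<Rightarrow> real" where G:
    "\<And>r Y. r > 0 \<Longrightarrow> f (X0 * r ^ d, Y) = (cmod ((1 - of_real r * t) ^ d - of_real Y))\<^sup>2 * G r Y"
    "continuous_on UNIV (\<lambda>x. G (fst x) (snd x))" "G 1 Y0 \<noteq> 0"
    "even d \<Longrightarrow> X0 < 0 \<or> Y0 < 0 \<Longrightarrow> G 1 Y0 > 0"
    by (rule fermat_node_factorization[OF d _ t], erule f, rule that)
  define \<sigma> where "\<sigma> = sgn (G 1 Y0)"
  have "t \<noteq> 0" using t(3) by auto
  then have X0: "X0 \<noteq> 0" using t(1) by auto
  \<comment> \<open>The inverse of \<open>r \<mapsto> X0 * r^d\<close> near \<open>r = 1\<close>;
    close to \<open>X0\<close> the quotient \<open>X / X0\<close> is positive, so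
    \<open>root d\<close> is differentiable there.\<close>
  define R where "R = (\<lambda>X. root d (X / X0))"
  have R1: "R X0 = 1" using X0 d by (simp add: R_def)
  have fR: "f (X, Y) = (cmod ((1 - of_real (R X) * t) ^ d - of_real Y))\<^sup>2 * G (R X) Y" if "X / X0 > 0" for X Y
  proof -
    have "R X > 0" using that d by (simp add: R_def)
    moreover have "X0 * R X ^ d = X" using that d X0 by (simp add: R_def real_root_pow_pos2)
    ultimately show ?thesis using G(1)[of "R X" Y] by simp
  qed
  have tends: "((\<lambda>a. G (R (u a)) (w a)) \<longlongrightarrow> G 1 Y0) F"
    if "(u \<longlongrightarrow> X0) F" "(w \<longlongrightarrow> Y0) F" for u w :: "'b \<Rightarrow> real" and F
  proof -
    have "((\<lambda>a. R (u a)) \<longlongrightarrow> R X0) F"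
      unfolding R_def by (intro tendsto_intros that) (use X0 in auto)
    then have "((\<lambda>a. (R (u a), w a)) \<longlongrightarrow> (1, Y0)) F" using that(2) R1 by (intro tendsto_Pair) auto
    from continuous_on_tendsto_compose[OF G(2) this] show ?thesis by simp
  qed
  have pos: "\<forall>\<^sub>F a in F. u a / X0 > 0" if "(u \<longlongrightarrow> X0) F" for u :: "'b \<Rightarrow> real" and F
  proof -
    have "((\<lambda>a. u a / X0) \<longlongrightarrow> X0 / X0) F" by (intro tendsto_intros that X0)
    then show ?thesis by (rule order_tendstoD) (use X0 in simp)
  qed
  have f0: "f (X0, Y0) = 0" using fR[of X0 Y0] X0 t by (simp add: R1)
  moreover have "\<forall>\<^sub>F x in nhds (X0, Y0). \<sigma> * f x \<ge> 0"
  proof -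
    have fst: "(fst \<longlongrightarrow> X0) (nhds (X0, Y0))" and snd: "(snd \<longlongrightarrow> Y0) (nhds (X0, Y0))"
      using tendsto_fst[OF filterlim_ident[of "nhds (X0, Y0)"]] tendsto_snd[OF filterlim_ident[of "nhds (X0, Y0)"]]
      by simp_all
    have "((\<lambda>x. \<sigma> * G (R (fst x)) (snd x)) \<longlongrightarrow> \<sigma> * G 1 Y0) (nhds (X0, Y0))"
      by (intro tendsto_mult tendsto_const tends fst snd)
    moreover have "\<sigma> * G 1 Y0 > 0" using G(3) by (simp add: \<sigma>_def sgn_if)
    ultimately have "\<forall>\<^sub>F x in nhds (X0, Y0). \<sigma> * G (R (fst x)) (snd x) > 0" by (rule order_tendstoD)
    with pos[OF fst] show ?thesis
    proof eventually_elim
      case (elim x)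
      have e: "\<sigma> * f x = (cmod ((1 - of_real (R (fst x)) * t) ^ d - of_real (snd x)))\<^sup>2 * (\<sigma> * G (R (fst x)) (snd x))"
        using fR[OF elim(1), of "snd x"] by simp
      show ?case unfolding e by (rule mult_nonneg_nonneg[OF zero_le_power2 less_imp_le[OF elim(2)]])
    qed
  qed
  moreover have "\<sigma> * H (X0, Y0) v > 0" if v: "v \<noteq> 0" for v
  proof -
    define a b where "a = fst v" and "b = snd v"
    have ab: "a \<noteq> 0 \<or> b \<noteq> 0" using v by (auto simp: a_def b_def prod_eq_iff)
    define A where "A = (\<lambda>s. (1 - of_real (R (X0 + s * a)) * t) ^ d - of_real (Y0 + s * b))"
    define \<kappa> where "\<kappa> = t * (1 - t) ^ (d - 1)"
    have "((\<lambda>s. (X0 + s * a) / X0) has_real_derivative a / X0) (at 0)"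
      using X0 by (auto intro!: derivative_eq_intros)
    moreover have "(root d has_real_derivative 1 / real d) (at ((X0 + 0 * a) / X0))"
      using DERIV_real_root[of d 1] d X0 by (simp add: inverse_eq_divide)
    ultimately have "((\<lambda>s. R (X0 + s * a)) has_real_derivative (1 / real d) * (a / X0)) (at 0)"
      unfolding R_def by (rule DERIV_chain2[rotated])
    then have "((\<lambda>s. R (X0 + s * a)) has_real_derivative a / (X0 * d)) (at 0)" by (simp add: mult.commute)
    then have "((\<lambda>s. of_real (R (X0 + s * a))) has_vector_derivative of_real (a / (X0 * d))) (at 0)"
      by (rule has_vector_derivative_of_real)
    moreover have "((\<lambda>z. (1 - z * t) ^ d) has_field_derivative - (of_nat d * \<kappa>)) (at (of_real (R (X0 + 0 * a))))"
      using d by (auto intro!: derivative_eq_intros simp: R1 \<kappa>_def mult_ac)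
    ultimately have "(((\<lambda>z. (1 - z * t) ^ d) \<circ> (\<lambda>s. of_real (R (X0 + s * a)))) has_vector_derivative of_real (a / (X0 * d)) * - (of_nat d * \<kappa>)) (at 0)"
      by (rule field_vector_diff_chain_at)
    moreover have "((\<lambda>s. Y0 + s * b) has_real_derivative b) (at 0)"
      by (auto intro!: derivative_eq_intros)
    then have "((\<lambda>s. complex_of_real (Y0 + s * b)) has_vector_derivative of_real b) (at 0)"
      by (rule has_vector_derivative_of_real)
    ultimately have "(A has_vector_derivative (of_real (a / (X0 * d)) * - (of_nat d * \<kappa>) - of_real b)) (at 0)"
      unfolding A_def o_def by (rule has_vector_derivative_diff)
    also have "of_real (a / (X0 * d)) * - (of_nat d * \<kappa>) - of_real b = - (of_real (a / X0) * \<kappa>) - of_real b"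
      using d by simp
    finally have A: "(A has_vector_derivative - (of_real (a / X0) * \<kappa>) - of_real b) (at 0)" .
    \<comment> \<open>The derivative at 0 of the vanishing factor along the direction
      \<open>(a, b)\<close>; the second derivative of \<open>f\<close> along it is twice the squared
      modulus of \<open>A'\<close> times \<open>G 1 Y0\<close>.\<close>
    define A' where "A' = - (of_real (a / X0) * \<kappa>) - of_real b"
    have A0: "A 0 = 0" using t by (simp add: A_def R1)
    have "((\<lambda>s. Re (A s)) has_real_derivative Re A') (at 0)" "((\<lambda>s. Im (A s)) has_real_derivative Im A') (at 0)"
      using bounded_linear.has_vector_derivative[OF bounded_linear_Re A] bounded_linear.has_vector_derivative[OF bounded_linear_Im A]
      by (simp_all add: has_real_derivative_iff_has_vector_derivative A'_def)
    then have "((\<lambda>s. Re (A s) / s) \<longlongrightarrow> Re A') (at 0)" "((\<lambda>s. Im (A s) / s) \<longlongrightarrow> Im A') (at 0)"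
      by (simp_all add: DERIV_def A0)
    then have "((\<lambda>s. ((Re (A s) / s)\<^sup>2 + (Im (A s) / s)\<^sup>2) * G (R (X0 + s * a)) (Y0 + s * b)) \<longlongrightarrow>
        ((Re A')\<^sup>2 + (Im A')\<^sup>2) * G 1 Y0) (at 0)"
      by (intro tendsto_mult tendsto_add tendsto_power tends) (auto intro!: tendsto_eq_intros)
    moreover have "\<forall>\<^sub>F s in at 0. ((Re (A s) / s)\<^sup>2 + (Im (A s) / s)\<^sup>2) * G (R (X0 + s * a)) (Y0 + s * b) =
        f ((X0, Y0) + s *\<^sub>R v) / s\<^sup>2"
    proof -
      have "((\<lambda>s. X0 + s * a) \<longlongrightarrow> X0) (at 0)" by (auto intro!: tendsto_eq_intros)
      from pos[OF this] show ?thesis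
      proof eventually_elim
        case (elim s)
        have "(X0, Y0) + s *\<^sub>R v = (X0 + s * a, Y0 + s * b)" by (simp add: a_def b_def prod_eq_iff)
        then have "f ((X0, Y0) + s *\<^sub>R v) = (cmod (A s))\<^sup>2 * G (R (X0 + s * a)) (Y0 + s * b)"
          using fR[OF elim] by (simp add: A_def)
        then show ?case by (simp add: cmod_power2 power_divide flip: add_divide_distrib)
      qed
    qed
    ultimately have "((\<lambda>s. f ((X0, Y0) + s *\<^sub>R v) / s\<^sup>2) \<longlongrightarrow> ((Re A')\<^sup>2 + (Im A')\<^sup>2) * G 1 Y0) (at 0)"
      by (rule Lim_transform_eventually)
    from hessian_from_quadratic_limit[OF H f0 this]
    have "\<sigma> * H (X0, Y0) v = 2 * ((Re A')\<^sup>2 + (Im A')\<^sup>2) * \<bar>G 1 Y0\<bar>"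
      by (simp add: \<sigma>_def abs_sgn)
    \<comment> \<open>Only \<open>\<kappa>\<close> contributes to the imaginary part and it is not
      real, so \<open>a = 0\<close>; the real part then gives \<open>b = 0\<close>.\<close>
    moreover have "A' \<noteq> 0"
    proof
      assume "A' = 0"
      then have im: "Im A' = 0" and re: "Re A' = 0" by simp_all
      from im have "a = 0" using X0 root_curve_slope_not_real[OF t(3,2) d] by (simp add: A'_def \<kappa>_def)
      with re ab show False by (simp add: A'_def)
    qed
    then have "(Re A')\<^sup>2 + (Im A')\<^sup>2 > 0" by (metis cmod_power2 zero_less_norm_iff zero_less_power)
    ultimately show ?thesis using G(3) by simp
  qed
  moreover have "\<sigma> = 1 \<or> \<sigma> = -1" using G(3) by (auto simp: \<sigma>_def sgn_if)
  moreover have "\<sigma> = 1" if "even d" "X0 < 0 \<or> Y0 < 0" using G(4)[OF that] by (simp add: \<sigma>_def)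
  ultimately show ?thesis by (intro that[of \<sigma>])
qed

section \<open>Polynomials in the plane and interpolation at the nodes\<close>

lemma plane_polyI:
  assumes "\<And>i j. i + j > d \<Longrightarrow> c i j = 0" "\<And>x y. h (x, y) = (\<Sum>i\<le>d. \<Sum>j\<le>d. c i j * x ^ i * y ^ j)"
  shows "plane_poly d h"
  unfolding plane_poly_def using assms by blast

lemma plane_poly_add:
  assumes "plane_poly d f" "plane_poly d g"
  shows "plane_poly d (\<lambda>p. f p + g p)"
proof -
  obtain c c' where "\<And>i j. i + j > d \<Longrightarrow> c i j = 0" "\<And>x y. f (x, y) = (\<Sum>i\<le>d. \<Sum>j\<le>d. c i j * x ^ i * y ^ j)"
    and "\<And>i j. i + j > d \<Longrightarrow> c' i j = 0" "\<And>x y. g (x, y) = (\<Sum>i\<le>d. \<Sum>j\<le>d. c' i j * x ^ i * y ^ j)"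
    using assms unfolding plane_poly_def by blast
  then show ?thesis
    by (intro plane_polyI[where c = "\<lambda>i j. c i j + c' i j"]) (simp_all add: distrib_right sum.distrib)
qed

lemma plane_poly_cmult:
  assumes "plane_poly d f"
  shows "plane_poly d (\<lambda>p. k * f p)"
proof -
  obtain c where "\<And>i j. i + j > d \<Longrightarrow> c i j = 0" "\<And>x y. f (x, y) = (\<Sum>i\<le>d. \<Sum>j\<le>d. c i j * x ^ i * y ^ j)"
    using assms unfolding plane_poly_def by blast
  then show ?thesis
    by (intro plane_polyI[where c = "\<lambda>i j. k * c i j"]) (simp_all add: sum_distrib_left mult.assoc)
qed

lemma plane_poly_sum:
  assumes "finite A" "\<And>a. a \<in> A \<Longrightarrow> plane_poly d (f a)"
  shows "plane_poly d (\<lambda>p. \<Sum>a\<in>A. f a p)"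
  using assms
proof (induction A)
  case empty
  show ?case by (intro plane_polyI[where c = "\<lambda>i j. 0"]) simp_all
next
  case (insert a A)
  then show ?case using plane_poly_add[of d "f a"] by simp
qed

lemma plane_poly_mono:
  assumes "plane_poly d f" "d \<le> e"
  shows "plane_poly e f"
proof -
  obtain c where c: "\<And>i j. i + j > d \<Longrightarrow> c i j = 0" "\<And>x y. f (x, y) = (\<Sum>i\<le>d. \<Sum>j\<le>d. c i j * x ^ i * y ^ j)"
    using assms unfolding plane_poly_def by blast
  have "f (x, y) = (\<Sum>i\<le>e. \<Sum>j\<le>e. c i j * x ^ i * y ^ j)" for x y
  proof -
    have "f (x, y) = (\<Sum>i\<le>d. \<Sum>j\<le>e. c i j * x ^ i * y ^ j)"
      unfolding c(2) using assms(2) by (intro sum.cong refl sum.mono_neutral_left) (auto simp: c(1))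
    also have "\<dots> = (\<Sum>i\<le>e. \<Sum>j\<le>e. c i j * x ^ i * y ^ j)"
      using assms(2) by (intro sum.mono_neutral_left) (auto simp: c(1))
    finally show ?thesis .
  qed
  then show ?thesis by (intro plane_polyI[where c = c]) (use c assms(2) in auto)
qed

text \<open>The truncated exponents \<open>i - 1\<close> and \<open>i - 2\<close> are harmless:
  wherever truncation occurs the coefficient \<open>i\<close> or \<open>i * (i - 1)\<close> is 0,
  and likewise for \<open>j\<close>.\<close>

lemma has_hessian_monomial:
  "has_hessian (\<lambda>p::real \<times> real. fst p ^ i * snd p ^ j)
    (\<lambda>p v. real i * real (i - 1) * fst p ^ (i - 2) * (fst v)\<^sup>2 * snd p ^ j
      + 2 * real i * real j * fst p ^ (i - 1) * snd p ^ (j - 1) * fst v * snd v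
      + real j * real (j - 1) * fst p ^ i * snd p ^ (j - 2) * (snd v)\<^sup>2)"
proof (rule has_hessianI[where D = "\<lambda>p v. real i * fst p ^ (i - 1) * fst v * snd p ^ j + real j * fst p ^ i * snd p ^ (j - 1) * snd v"])
  fix x v :: "real \<times> real" and s :: real
  obtain x1 x2 v1 v2 where xv: "x = (x1, x2)" "v = (v1, v2)" by (cases x, cases v) auto
  show "((\<lambda>s. fst (x + s *\<^sub>R v) ^ i * snd (x + s *\<^sub>R v) ^ j) has_real_derivative
      real i * fst (x + s *\<^sub>R v) ^ (i - 1) * fst v * snd (x + s *\<^sub>R v) ^ j +
      real j * fst (x + s *\<^sub>R v) ^ i * snd (x + s *\<^sub>R v) ^ (j - 1) * snd v) (at s)"
    unfolding xv by (auto intro!: derivative_eq_intros simp: algebra_simps)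
  show "((\<lambda>s. real i * fst (x + s *\<^sub>R v) ^ (i - 1) * fst v * snd (x + s *\<^sub>R v) ^ j +
        real j * fst (x + s *\<^sub>R v) ^ i * snd (x + s *\<^sub>R v) ^ (j - 1) * snd v) has_real_derivative
      real i * real (i - 1) * fst (x + s *\<^sub>R v) ^ (i - 2) * (fst v)\<^sup>2 * snd (x + s *\<^sub>R v) ^ j
      + 2 * real i * real j * fst (x + s *\<^sub>R v) ^ (i - 1) * snd (x + s *\<^sub>R v) ^ (j - 1) * fst v * snd v
      + real j * real (j - 1) * fst (x + s *\<^sub>R v) ^ i * snd (x + s *\<^sub>R v) ^ (j - 2) * (snd v)\<^sup>2) (at s)"
    unfolding xv by (auto intro!: derivative_eq_intros simp: algebra_simps power2_eq_square numeral_2_eq_2)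
next
  show "continuous_on UNIV (\<lambda>z. real i * real (i - 1) * fst (fst z) ^ (i - 2) * (fst (snd z))\<^sup>2 * snd (fst z) ^ j
      + 2 * real i * real j * fst (fst z) ^ (i - 1) * snd (fst z) ^ (j - 1) * fst (snd z) * snd (snd z)
      + real j * real (j - 1) * fst (fst z) ^ i * snd (fst z) ^ (j - 2) * (snd (snd z))\<^sup>2)"
    by (intro continuous_intros)
qed (simp add: power2_eq_square algebra_simps)

lemma plane_poly_hessian:
  assumes "plane_poly d f"
  obtains H where "has_hessian f H" "continuous_on UNIV f"
proof -
  obtain c where "\<And>x y. f (x, y) = (\<Sum>i\<le>d. \<Sum>j\<le>d. c i j * x ^ i * y ^ j)"
    using assms unfolding plane_poly_def by blast
  then have f: "f = (\<lambda>p. \<Sum>i\<le>d. \<Sum>j\<le>d. c i j * (fst p ^ i * snd p ^ j))"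
    by (auto simp: fun_eq_iff mult.assoc)
  have "\<forall>i j. \<exists>M. has_hessian (\<lambda>p::real \<times> real. fst p ^ i * snd p ^ j) M"
    by (intro allI exI) (rule has_hessian_monomial)
  then obtain M where M: "\<And>i j. has_hessian (\<lambda>p::real \<times> real. fst p ^ i * snd p ^ j) (M i j)" by metis
  have "has_hessian f (\<lambda>p v. \<Sum>i\<le>d. \<Sum>j\<le>d. c i j * M i j p v)"
    unfolding f by (intro has_hessian_sum has_hessian_cmult M finite_atMost)
  moreover have "continuous_on UNIV f" unfolding f by (intro continuous_intros)
  ultimately show ?thesis using that by blast
qed

section \<open>Linear systems over finite index sets\<close>

lemma underdetermined_system:
  fixes M :: "'a \<Rightarrow> 'b \<Rightarrow> real"
  assumes "finite A" "finite B" "card A < card B"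
  shows "\<exists>c. (\<exists>b\<in>B. c b \<noteq> 0) \<and> (\<forall>a\<in>A. (\<Sum>b\<in>B. M a b * c b) = 0)"
  using assms
proof (induction A arbitrary: B M)
  case empty
  then have "B \<noteq> {}" by auto
  then show ?case by (intro exI[of _ "\<lambda>_. 1"]) auto
next
  case (insert a A)
  show ?case
  proof (cases "\<forall>b\<in>B. M a b = 0")
    case True
    have "card A < card B" using insert by simp
    from insert.IH[OF insert.prems(1) this, of M] True show ?thesis by (auto simp: insert.hyps)
  next
    case False
    then obtain b0 where b0: "b0 \<in> B" "M a b0 \<noteq> 0" by blast
    define B1 where "B1 = B - {b0}"
    have B1: "finite B1" "card A < card B1" "b0 \<notin> B1" "B = insert b0 B1"
      using insert b0 by (auto simp: B1_def)
    \<comment> \<open>Gaussian elimination: equation \<open>a\<close> is solved for the unknown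
      \<open>b0\<close>, and the result is substituted into the others.\<close>
    from insert.IH[OF B1(1,2), of "\<lambda>a' b. M a' b - M a' b0 * M a b / M a b0"]
    obtain c where c: "\<exists>b\<in>B1. c b \<noteq> 0" "\<And>a'. a' \<in> A \<Longrightarrow> (\<Sum>b\<in>B1. (M a' b - M a' b0 * M a b / M a b0) * c b) = 0"
      by blast
    define k where "k = - (\<Sum>b\<in>B1. M a b * c b) / M a b0"
    define c' where "c' = c(b0 := k)"
    have sum: "(\<Sum>b\<in>B. M x b * c' b) = M x b0 * k + (\<Sum>b\<in>B1. M x b * c b)" for x
    proof -
      have "(\<Sum>b\<in>B1. M x b * c' b) = (\<Sum>b\<in>B1. M x b * c b)"
        using B1(3) by (intro sum.cong) (auto simp: c'_def)
      then show ?thesis unfolding B1(4) using B1(1,3) by (simp add: c'_def)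
    qed
    have "(\<Sum>b\<in>B. M a b * c' b) = 0" unfolding sum k_def using b0 by simp
    moreover have "(\<Sum>b\<in>B. M a' b * c' b) = 0" if "a' \<in> A" for a'
    proof -
      have "(\<Sum>b\<in>B1. (M a' b - M a' b0 * M a b / M a b0) * c b) = (\<Sum>b\<in>B1. M a' b * c b - M a' b0 / M a b0 * (M a b * c b))"
        by (intro sum.cong) (auto simp: left_diff_distrib)
      also have "\<dots> = (\<Sum>b\<in>B1. M a' b * c b) - M a' b0 / M a b0 * (\<Sum>b\<in>B1. M a b * c b)"
        by (simp add: sum_subtractf sum_distrib_left)
      finally have "(\<Sum>b\<in>B1. M a' b * c b) = M a' b0 / M a b0 * (\<Sum>b\<in>B1. M a b * c b)" using c(2)[OF that] by simp
      then show ?thesis unfolding sum k_def by simp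
    qed
    moreover have "\<exists>b\<in>B. c' b \<noteq> 0"
    proof -
      obtain b where "b \<in> B1" "c b \<noteq> 0" using c(1) by blast
      then show ?thesis using B1 by (intro bexI[of _ b]) (auto simp: c'_def)
    qed
    ultimately show ?thesis by (intro exI[of _ c']) auto
  qed
qed

text \<open>The right-hand side becomes an additional column \<open>- y\<close>, so the homogeneous
  system has more unknowns than equations. Injectivity forces the additional unknown of a nontrivial
  solution to be nonzero, and dividing by it solves the system.\<close>

lemma injective_system_solvable:
  fixes M :: "'a \<Rightarrow> 'b \<Rightarrow> real"
  assumes "finite A" "finite B" "card A = card B"
    and inj: "\<And>c. (\<And>a. a \<in> A \<Longrightarrow> (\<Sum>b\<in>B. M a b * c b) = 0) \<Longrightarrow> \<forall>b\<in>B. c b = 0"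
  shows "\<exists>c. \<forall>a\<in>A. (\<Sum>b\<in>B. M a b * c b) = y a"
proof -
  define B' where "B' = insert None (Some ` B)"
  define M' where "M' = (\<lambda>a b. case b of None \<Rightarrow> - y a | Some b \<Rightarrow> M a b)"
  have B': "finite B'" "card A < card B'" using assms by (auto simp: B'_def card_image)
  from underdetermined_system[OF assms(1) this, of M']
  obtain c where c: "\<exists>b\<in>B'. c b \<noteq> 0" "\<And>a. a \<in> A \<Longrightarrow> (\<Sum>b\<in>B'. M' a b * c b) = 0" by blast
  have sum: "(\<Sum>b\<in>B'. M' a b * c b) = (\<Sum>b\<in>B. M a b * c (Some b)) - y a * c None" for a
    using assms(2) by (simp add: B'_def M'_def sum.reindex)
  have "c None \<noteq> 0"
  proof
    assume "c None = 0"
    then have "\<forall>b\<in>B. c (Some b) = 0" using c(2) unfolding sum by (intro inj) simp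
    then show False using c(1) \<open>c None = 0\<close> by (auto simp: B'_def)
  qed
  moreover have "(\<Sum>b\<in>B. M a b * (c (Some b) / c None)) = (\<Sum>b\<in>B. M a b * c (Some b)) / c None" for a
    by (simp add: sum_divide_distrib)
  ultimately show ?thesis using c(2) unfolding sum by (intro exI[of _ "\<lambda>b. c (Some b) / c None"]) simp
qed

text \<open>For fixed \<open>s\<close> the \<open>d\<close> parameters \<open>t = 1 - z s\<close> with \<open>z ^ d = 1\<close> give the same \<open>(1 - t) ^ d\<close> but in general
  distinct \<open>t ^ d\<close>.\<close>

lemma fermat_curve_monomials_independent:
  fixes c :: "nat \<Rightarrow> nat \<Rightarrow> complex"
  assumes d: "e < d"
    and z: "\<And>t. (\<Sum>i\<le>e. \<Sum>j\<le>e. c i j * (t ^ d) ^ i * ((1 - t) ^ d) ^ j) = 0"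
    and ij: "i \<le> e" "j \<le> e"
  shows "c i j = 0"
proof -
  define S where "S = {z::complex. z ^ d = 1}"
  have S: "finite S" "card S = d" using d by (auto simp: S_def card_complex_roots_unity finite_roots_unity)
  \<comment> \<open>\<open>(1 - z s)^d\<close> has derivative \<open>- d z\<close> at 0, so these
    differences are nonzero polynomials. Their finitely many roots are the \<open>s\<close> for
    which two of the \<open>d\<close> abscissae coincide.\<close>
  define E where "E = (\<lambda>z w. [:1, -z:] ^ d - [:1, -w:] ^ d :: complex poly)"
  have E: "E z w \<noteq> 0" if "z \<noteq> w" for z w
  proof
    assume "E z w = 0"
    then have "poly (pderiv (E z w)) 0 = 0" by simp
    then show False using that d by (simp add: E_def pderiv_diff pderiv_power poly_power pderiv_pCons)
  qed
  define Bad where "Bad = (\<Union>z\<in>S. \<Union>w\<in>S - {z}. {s. poly (E z w) s = 0})"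
  have "finite Bad" unfolding Bad_def using S E by (intro finite_UN_I finite_Diff poly_roots_finite) auto
  define q where "q = (\<Sum>j\<le>e. monom (c i j) (d * j))"
  have q0: "poly q s = 0" if "s \<notin> Bad" for s
  proof -
    \<comment> \<open>For fixed good \<open>s\<close> this polynomial of degree at most
      \<open>e < d\<close> vanishes at \<open>d\<close> distinct values, hence identically. Its
      coefficient at \<open>i\<close> is \<open>q\<close> evaluated at \<open>s\<close>.\<close>
    define p where "p = (\<Sum>i\<le>e. monom (\<Sum>j\<le>e. c i j * (s ^ d) ^ j) i)"
    have "p = 0"
    proof (rule ccontr)
      assume "p \<noteq> 0"
      have inj: "inj_on (\<lambda>z. (1 - z * s) ^ d) S"
      proof (rule inj_onI, rule ccontr)
        fix z w assume zw: "z \<in> S" "w \<in> S" "(1 - z * s) ^ d = (1 - w * s) ^ d" "z \<noteq> w"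
        then have "poly (E z w) s = 0" by (simp add: E_def poly_power mult.commute)
        then have "s \<in> Bad" unfolding Bad_def using zw by blast
        with that show False by simp
      qed
      have "(\<lambda>z. (1 - z * s) ^ d) ` S \<subseteq> {x. poly p x = 0}"
      proof
        fix x assume "x \<in> (\<lambda>z. (1 - z * s) ^ d) ` S"
        then obtain z where zS: "z \<in> S" "x = (1 - z * s) ^ d" by blast
        have "(1 - (1 - z * s)) ^ d = s ^ d" using zS(1) by (simp add: S_def power_mult_distrib)
        then have "(\<Sum>i\<le>e. \<Sum>j\<le>e. c i j * x ^ i * (s ^ d) ^ j) = 0" using z[of "1 - z * s"] zS(2) by simp
        moreover have "poly p x = (\<Sum>i\<le>e. \<Sum>j\<le>e. c i j * x ^ i * (s ^ d) ^ j)"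
          by (simp add: p_def poly_sum poly_monom sum_distrib_left mult_ac)
        ultimately show "x \<in> {x. poly p x = 0}" by simp
      qed
      then have "card ((\<lambda>z. (1 - z * s) ^ d) ` S) \<le> card {x. poly p x = 0}"
        by (intro card_mono poly_roots_finite \<open>p \<noteq> 0\<close>)
      also have "\<dots> \<le> degree p" by (rule card_poly_roots_bound[OF \<open>p \<noteq> 0\<close>])
      also have "degree p \<le> e"
        unfolding p_def by (rule degree_sum_le) (auto intro: order_trans[OF degree_monom_le])
      finally show False using d S by (simp add: card_image[OF inj])
    qed
    then have "coeff p i = 0" by simp
    then show ?thesis using ij by (simp add: p_def coeff_sum q_def poly_sum poly_monom power_mult)
  qed
  have "q = 0"
  proof (rule ccontr)
    assume "q \<noteq> 0"
    then have "finite ({s. poly q s = 0} \<union> Bad)" using poly_roots_finite \<open>finite Bad\<close> by auto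
    moreover have "{s. poly q s = 0} \<union> Bad = UNIV" using q0 by auto
    ultimately show False using infinite_UNIV_char_0[where 'a = complex] by simp
  qed
  then have "coeff q (d * j) = 0" by simp
  moreover have "coeff q (d * j) = c i j" using ij d by (simp add: q_def coeff_sum)
  ultimately show ?thesis by simp
qed

section \<open>Parameters, positions and number of the nodes\<close>

definition node_index :: "nat \<Rightarrow> (nat \<times> nat) set" where
  "node_index d = {(a, b). 1 \<le> a \<and> 1 \<le> b \<and> a + b < d}"

text \<open>The apex of the triangle on the base \<open>0, 1\<close> with base angles \<open>\<pi> a / d\<close> and \<open>\<pi> b / d\<close>; both
  \<open>t ^ d\<close> and \<open>(1 - t) ^ d\<close> are then real.\<close>

definition node_param :: "nat \<Rightarrow> nat \<times> nat \<Rightarrow> complex" where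
  "node_param d = (\<lambda>(a, b). of_real (sin (pi * b / d) / sin (pi * (a + b) / d)) * cis (pi * a / d))"

text \<open>The powers of the two sides at the apex: their lengths come from the law of sines with
  base 1, and the signs from \<open>cis (pi * a)\<close> and \<open>cis (- pi * b)\<close>.\<close>

definition node_point :: "nat \<Rightarrow> nat \<times> nat \<Rightarrow> real \<times> real" where
  "node_point d = (\<lambda>(a, b). ((-1) ^ a * (sin (pi * b / d) / sin (pi * (a + b) / d)) ^ d,
     (-1) ^ b * (sin (pi * a / d) / sin (pi * (a + b) / d)) ^ d))"

lemma finite_node_index: "finite (node_index d)"
  by (rule finite_subset[of _ "{..d} \<times> {..d}"]) (auto simp: node_index_def)

lemma sin_angle_pos:
  assumes "1 \<le> (a::nat)" "a < d"
  shows "sin (pi * a / d) > 0"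
  using assms by (intro sin_gt_zero) (auto simp: field_simps)

lemma cis_angle_power:
  assumes "d > 0"
  shows "cis (pi * real a / real d) ^ d = of_real ((-1) ^ a)"
proof -
  have "cis (pi * real a / real d) ^ d = cis (real a * pi)" using assms by (simp add: Complex.DeMoivre mult.commute)
  also have "\<dots> = cis pi ^ a" by (rule Complex.DeMoivre[symmetric])
  finally show ?thesis by simp
qed

lemma one_minus_node_param:
  assumes "(a, b) \<in> node_index d"
  shows "1 - node_param d (a, b) = of_real (sin (pi * a / d) / sin (pi * (a + b) / d)) * cis (- (pi * b / d))"
proof -
  have pos: "sin (pi * (a + b) / d) > 0" using sin_angle_pos[of "a + b" d] assms by (simp add: node_index_def)
  have "pi * (a + b) / d = pi * a / d + pi * b / d" by (simp add: distrib_left add_divide_distrib)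
  then have "sin (pi * (a + b) / d) = sin (pi * a / d) * cos (pi * b / d) + cos (pi * a / d) * sin (pi * b / d)"
    by (simp only: sin_add)
  then show ?thesis using pos by (simp add: node_param_def complex_eq_iff field_simps)
qed

lemma node_param_props:
  assumes "p \<in> node_index d"
  shows "node_param d p ^ d = of_real (fst (node_point d p))"
    and "(1 - node_param d p) ^ d = of_real (snd (node_point d p))"
    and "Im (node_param d p) > 0"
proof -
  obtain a b where p: "p = (a, b)" by fastforce
  have d: "d > 0" and ab: "1 \<le> a" "1 \<le> b" "a < d" "b < d" "a + b < d"
    using assms by (auto simp: p node_index_def)
  have pow: "(of_real r * cis x) ^ d = of_real (s * r ^ d)" if "cis x ^ d = of_real s" for r s x
    using that by (simp add: power_mult_distrib)
  show "node_param d p ^ d = of_real (fst (node_point d p))"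
    unfolding p node_param_def node_point_def prod.case fst_conv by (rule pow[OF cis_angle_power[OF d]])
  have "cis (- (pi * b / d)) ^ d = of_real ((-1) ^ b)"
    using cis_angle_power[OF d, of b] by (metis cis_cnj complex_cnj_complex_of_real complex_cnj_power)
  then show "(1 - node_param d p) ^ d = of_real (snd (node_point d p))"
    unfolding p one_minus_node_param[OF assms[unfolded p]] unfolding node_point_def prod.case snd_conv of_nat_add by (rule pow)
  show "Im (node_param d p) > 0"
    using sin_angle_pos[OF ab(1,3)] sin_angle_pos[OF ab(2,4)] sin_angle_pos[of "a + b" d] ab by (simp add: p node_param_def)
qed

lemma node_point_neg:
  assumes "(a, b) \<in> node_index d" "odd a \<or> odd b"
  shows "fst (node_point d (a, b)) < 0 \<or> snd (node_point d (a, b)) < 0"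
proof -
  have "sin (pi * a / d) > 0" "sin (pi * b / d) > 0" "sin (pi * (a + b) / d) > 0"
    using sin_angle_pos[of a d] sin_angle_pos[of b d] sin_angle_pos[of "a + b" d] assms(1) by (auto simp: node_index_def)
  then show ?thesis using assms(2) by (auto simp: node_point_def)
qed

lemma Arg_scaled_cis:
  assumes "r > 0" "-pi < x" "x \<le> pi"
  shows "Arg (of_real r * cis x) = x"
  by (rule cis_Arg_unique) (use assms in \<open>auto simp: sgn_mult sgn_of_real sgn_eq norm_mult\<close>)

text \<open>The arguments of \<open>t\<close> and \<open>1 - t\<close> recover the two base
  angles.\<close>

lemma inj_on_node_param: "inj_on (node_param d) (node_index d)"
proof (rule inj_onI)
  fix p q assume p: "p \<in> node_index d" and q: "q \<in> node_index d" and e: "node_param d p = node_param d q"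
  have A: "Arg (node_param d (a, b)) = pi * a / d \<and> Arg (1 - node_param d (a, b)) = - (pi * b / d)"
    if "(a, b) \<in> node_index d" for a b
  proof -
    have ab: "1 \<le> a" "1 \<le> b" "a < d" "b < d" "a + b < d" using that by (auto simp: node_index_def)
    have pos: "sin (pi * a / d) / sin (pi * (a + b) / d) > 0" "sin (pi * b / d) / sin (pi * (a + b) / d) > 0"
      using sin_angle_pos[of a d] sin_angle_pos[of b d] sin_angle_pos[of "a + b" d] ab by auto
    have lt: "pi * a / d < pi" "pi * b / d < pi" "pi * a / d > 0" "pi * b / d > 0"
      using ab by (auto simp: field_simps)
    show ?thesis
      unfolding one_minus_node_param[OF that] unfolding node_param_def prod.case of_nat_add
      by (intro conjI Arg_scaled_cis) (use pos[unfolded of_nat_add] lt in linarith)+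
  qed
  obtain a b where p': "p = (a, b)" by fastforce
  obtain a' b' where q': "q = (a', b')" by fastforce
  have "d > 0" using p by (auto simp: node_index_def)
  moreover have "pi * a / d = pi * a' / d" "pi * b / d = pi * b' / d"
    using A[of a b] A[of a' b'] p q e unfolding p' q' by (metis, metis neg_equal_iff_equal)
  ultimately show "p = q" by (simp add: p' q')
qed

text \<open>The moduli of the coordinates determine the distances of \<open>t\<close> to 0 and 1,
  hence \<open>t\<close> up to conjugation; the upper half-plane decides.\<close>

lemma inj_on_node_point: "inj_on (node_point d) (node_index d)"
proof (rule inj_onI)
  fix p q assume p: "p \<in> node_index d" and q: "q \<in> node_index d" and e: "node_point d p = node_point d q"
  have d: "d > 0" using p by (auto simp: node_index_def)
  have "cmod (node_param d p ^ d) = cmod (node_param d q ^ d)"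
    "cmod ((1 - node_param d p) ^ d) = cmod ((1 - node_param d q) ^ d)"
    by (simp_all only: node_param_props[OF p] node_param_props[OF q] e)
  then have "cmod (node_param d p) = cmod (node_param d q)" "cmod (1 - node_param d p) = cmod (1 - node_param d q)"
    using d power_eq_imp_eq_base[of "cmod (node_param d p)" d "cmod (node_param d q)"]
      power_eq_imp_eq_base[of "cmod (1 - node_param d p)" d "cmod (1 - node_param d q)"] by (simp_all add: norm_power)
  from same_modulus_pair[OF this] have "node_param d p = node_param d q"
    using node_param_props(3)[OF p] node_param_props(3)[OF q] by auto
  then show "p = q" using inj_on_node_param p q by (auto dest: inj_onD)
qed

lemma node_index_Sigma: "node_index d = (SIGMA a:{1..<d}. {1..<d - a})"
  by (auto simp: node_index_def)

lemma card_node_index: "2 * card (node_index d) = (d - 1) * (d - 2)"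
proof -
  have "card (node_index d) = (\<Sum>a=1..<d. d - a - 1)" unfolding node_index_Sigma by simp
  also have "2 * \<dots> = (d - 1) * (d - 2)"
  proof (induction d)
    case (Suc d)
    have "(\<Sum>a=1..<Suc d. Suc d - a - 1) = (\<Sum>a=1..<d. (d - a - 1) + 1)"
    proof (cases "d \<ge> 1")
      case True
      then have "(\<Sum>a=1..<Suc d. Suc d - a - 1) = (\<Sum>a=1..<d. Suc d - a - 1)" by simp
      also have "\<dots> = (\<Sum>a=1..<d. (d - a - 1) + 1)" by (intro sum.cong) auto
      finally show ?thesis .
    qed simp
    also have "\<dots> = (\<Sum>a=1..<d. d - a - 1) + (d - 1)" by (simp only: sum.distrib sum_constant card_atLeastLessThan) simp
    finally have "2 * (\<Sum>a=1..<Suc d. Suc d - a - 1) = (d - 1) * (d - 2) + 2 * (d - 1)" using Suc.IH by simp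
    also have "\<dots> = (d - 1) * (d - 2 + 2)" by (simp add: algebra_simps)
    also have "\<dots> = (Suc d - 1) * (Suc d - 2)"
    proof (cases "d \<le> 1")
      case False
      then have "d - 2 + 2 = d" by simp
      then show ?thesis by (simp only: mult.commute) simp
    qed (auto simp: le_Suc_eq)
    finally show ?case .
  qed simp
  finally show ?thesis .
qed

text \<open>Adding 1 to both exponents turns the monomials of degree at most \<open>e\<close> into
  the nodes for \<open>e + 3\<close>. This makes interpolation in degree \<open>d - 3\<close> a
  square system.\<close>

lemma card_triangle: "2 * card {(i, j). i + j \<le> (e::nat)} = (e + 1) * (e + 2)"
proof -
  have "{(i, j). i + j \<le> e} = (\<lambda>(a, b). (a - 1, b - 1)) ` node_index (e + 3)"
  proof (intro equalityI subsetI)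
    fix x assume "x \<in> {(i, j). i + j \<le> e}"
    then obtain i j where "x = (i, j)" "i + j \<le> e" by auto
    then show "x \<in> (\<lambda>(a, b). (a - 1, b - 1)) ` node_index (e + 3)"
      by (intro image_eqI[of _ _ "(i + 1, j + 1)"]) (auto simp: node_index_def)
  qed (auto simp: node_index_def)
  moreover have "inj_on (\<lambda>(a, b). (a - 1, b - 1)) (node_index (e + 3))" by (auto simp: inj_on_def node_index_def)
  ultimately have "card {(i, j). i + j \<le> e} = card (node_index (e + 3))" by (simp add: card_image)
  then show ?thesis using card_node_index[of "e + 3"] by (simp add: mult.commute)
qed

text \<open>A polynomial of degree \<open>d - 3\<close> vanishing at all nodes pulls back to a polynomial in \<open>t\<close> of degree at
  most \<open>d (d - 3)\<close> with the \<open>(d - 1) (d - 2)\<close> zeros given by the node parameters and their conjugates.\<close>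

lemma node_interpolation:
  assumes d: "d \<ge> 3" and q: "q \<in> node_index d"
  shows "\<exists>g. plane_poly (d - 3) g \<and> (\<forall>p\<in>node_index d. g (node_point d p) = (if p = q then 1 else 0))"
proof -
  define e where "e = d - 3"
  have de: "d = e + 3" using d by (simp add: e_def)
  define B where "B = {(i, j). i + j \<le> e}"
  define M where "M = (\<lambda>p (i, j). fst (node_point d p) ^ i * snd (node_point d p) ^ j)"
  have finB: "finite B" by (rule finite_subset[of _ "{..e} \<times> {..e}"]) (auto simp: B_def)
  have card: "card (node_index d) = card B"
    using card_triangle[of e] card_node_index[of d] by (simp add: B_def de mult.commute)
  have sumB: "(\<Sum>b\<in>B. F b) = (\<Sum>i\<le>e. \<Sum>j\<le>e. if i + j \<le> e then F (i, j) else 0)" for F :: "nat \<times> nat \<Rightarrow> 'z::comm_monoid_add"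
  proof -
    have "(\<Sum>b\<in>B. F b) = (\<Sum>b\<in>{..e} \<times> {..e}. if b \<in> B then F b else 0)"
      by (subst sum.inter_restrict[symmetric]) (auto intro!: sum.cong simp: B_def)
    also have "\<dots> = (\<Sum>i\<le>e. \<Sum>j\<le>e. if (i, j) \<in> B then F (i, j) else 0)"
      by (simp add: sum.cartesian_product case_prod_unfold cong: if_cong)
    finally show ?thesis by (simp add: B_def)
  qed
  have "\<exists>c. \<forall>p\<in>node_index d. (\<Sum>b\<in>B. M p b * c b) = (if p = q then 1 else 0)"
  proof (rule injective_system_solvable[OF finite_node_index finB card])
    fix c assume c: "\<And>p. p \<in> node_index d \<Longrightarrow> (\<Sum>b\<in>B. M p b * c b) = 0"
    define C where "C = (\<lambda>i j. if i + j \<le> e then c (i, j) else 0)"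
    define G :: "complex poly" where
      "G = (\<Sum>i\<le>e. \<Sum>j\<le>e. smult (of_real (C i j)) (([:0, 1:] ^ d) ^ i * ([:1, -1:] ^ d) ^ j))"
    have Gt: "poly G t = (\<Sum>i\<le>e. \<Sum>j\<le>e. of_real (C i j) * (t ^ d) ^ i * ((1 - t) ^ d) ^ j)" for t
      by (simp add: G_def poly_sum poly_power mult.assoc)
    have root: "poly G t = 0" if "t = node_param d p \<or> t = cnj (node_param d p)" "p \<in> node_index d" for t p
    proof -
      have "(cnj u) ^ d = cnj (u ^ d)" "(1 - cnj u) ^ d = cnj ((1 - u) ^ d)" for u by simp_all
      then have "t ^ d = of_real (fst (node_point d p))" "(1 - t) ^ d = of_real (snd (node_point d p))"
        using that(1) node_param_props(1,2)[OF that(2)] by (elim disjE; simp only: complex_cnj_complex_of_real)+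
      then have "poly G t = of_real (\<Sum>i\<le>e. \<Sum>j\<le>e. C i j * fst (node_point d p) ^ i * snd (node_point d p) ^ j)"
        unfolding Gt by simp
      also have "(\<Sum>i\<le>e. \<Sum>j\<le>e. C i j * fst (node_point d p) ^ i * snd (node_point d p) ^ j) = (\<Sum>b\<in>B. M p b * c b)"
        unfolding sumB by (intro sum.cong) (auto simp: C_def M_def mult_ac)
      finally show ?thesis using c[OF that(2)] by simp
    qed
    have "G = 0"
    proof (rule ccontr)
      assume "G \<noteq> 0"
      let ?T = "node_param d ` node_index d"
      have "?T \<inter> cnj ` ?T = {}"
      proof -
        have "Im t > 0" if "t \<in> ?T" for t using that node_param_props(3) by auto
        moreover have "Im t < 0" if "t \<in> cnj ` ?T" for t using that node_param_props(3) by auto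
        ultimately show ?thesis by (metis disjoint_iff less_asym)
      qed
      then have "card (?T \<union> cnj ` ?T) = card ?T + card (cnj ` ?T)"
        by (intro card_Un_disjoint finite_imageI finite_node_index)
      also have "\<dots> = 2 * card (node_index d)"
        by (simp add: card_image[OF inj_on_node_param] card_image[of cnj] inj_on_def)
      also have "\<dots> = (d - 1) * (d - 2)" by (rule card_node_index)
      finally have "(d - 1) * (d - 2) = card (?T \<union> cnj ` ?T)" by simp
      also have "\<dots> \<le> card {t. poly G t = 0}"
        by (intro card_mono poly_roots_finite \<open>G \<noteq> 0\<close>) (use root in auto)
      also have "\<dots> \<le> degree G" by (rule card_poly_roots_bound[OF \<open>G \<noteq> 0\<close>])
      also have "\<dots> \<le> d * e"
        unfolding G_def
      proof (intro degree_sum_le finite_atMost)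
        fix i j assume "i \<in> {..e}" "j \<in> {..e}"
        show "degree (smult (of_real (C i j)) (([:0, 1:] ^ d) ^ i * ([:1, -1:] ^ d) ^ j) :: complex poly) \<le> d * e"
        proof (cases "i + j \<le> e")
          case True
          have "degree ([:1, -1:] ^ (d * j) :: complex poly) \<le> d * j"
            using degree_power_le[of "[:1, -1:] :: complex poly" "d * j"] by simp
          moreover have "degree ([:0, 1:] ^ (d * i) :: complex poly) \<le> d * i"
            using degree_power_le[of "[:0, 1:] :: complex poly" "d * i"] by simp
          ultimately have "degree (([:0, 1:] ^ d) ^ i * ([:1, -1:] ^ d) ^ j :: complex poly) \<le> d * i + d * j"
            unfolding power_mult[symmetric] by (intro order_trans[OF degree_mult_le] add_mono)
          also have "\<dots> \<le> d * e" using True by (simp flip: distrib_left)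
          finally show ?thesis by (rule order_trans[OF degree_smult_le])
        qed (simp add: C_def)
      qed
      \<comment> \<open>With \<open>d = e + 3\<close> the number of roots
        \<open>(d - 1) * (d - 2)\<close> equals \<open>d * e + 2\<close>, two more than the degree
        allows.\<close>
      finally show False by (simp add: de algebra_simps)
    qed
    then have z: "(\<Sum>i\<le>e. \<Sum>j\<le>e. complex_of_real (C i j) * (t ^ d) ^ i * ((1 - t) ^ d) ^ j) = 0" for t
      using Gt[of t] by simp
    have "C i j = 0" if "i \<le> e" "j \<le> e" for i j
      using fermat_curve_monomials_independent[OF _ z that] by (simp add: de)
    then have "c (i, j) = 0" if "i + j \<le> e" for i j
      using that unfolding C_def by (metis add_leD1 add_leD2)
    then show "\<forall>b\<in>B. c b = 0" by (auto simp: B_def)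
  qed
  then obtain c where c: "\<And>p. p \<in> node_index d \<Longrightarrow> (\<Sum>b\<in>B. M p b * c b) = (if p = q then 1 else 0)" by blast
  define g where "g = (\<lambda>p. \<Sum>i\<le>e. \<Sum>j\<le>e. (if i + j \<le> e then c (i, j) else 0) * fst p ^ i * snd p ^ j)"
  have "plane_poly e g" by (rule plane_polyI[where c = "\<lambda>i j. if i + j \<le> e then c (i, j) else 0"]) (auto simp: g_def)
  moreover have "g (node_point d p) = (\<Sum>b\<in>B. M p b * c b)" for p
    unfolding g_def sumB by (intro sum.cong) (auto simp: M_def)
  ultimately show ?thesis using c unfolding e_def by auto
qed

section \<open>Chebyshev polynomials\<close>

lemma chebyshev_exists:
  "\<exists>q::real poly. degree q \<le> n \<and> (\<forall>x. poly q (cos x) = cos (real n * x))"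
proof (induction n rule: induct_nat_012)
  case 0
  show ?case by (intro exI[of _ 1]) simp
next
  case 1
  show ?case by (intro exI[of _ "[:0, 1:]"]) simp
next
  case (ge2 n)
  then obtain p q :: "real poly" where p: "degree p \<le> n" "\<And>x. poly p (cos x) = cos (real n * x)"
    and q: "degree q \<le> Suc n" "\<And>x. poly q (cos x) = cos (real (Suc n) * x)" by auto
  have "degree ([:0, 2:] * q - p) \<le> Suc (Suc n)"
    using p(1) q(1) degree_mult_le[of "[:0, 2:]" q] by (intro degree_diff_le) auto
  moreover have "poly ([:0, 2:] * q - p) (cos x) = cos (real (Suc (Suc n)) * x)" for x
  proof -
    have "cos (real (Suc n) * x + x) + cos (real (Suc n) * x - x) = 2 * cos (real (Suc n) * x) * cos x"
      by (simp add: cos_add cos_diff)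
    moreover have "real (Suc n) * x + x = real (Suc (Suc n)) * x" "real (Suc n) * x - x = real n * x"
      by (simp_all add: algebra_simps)
    ultimately have "cos (real (Suc (Suc n)) * x) + cos (real n * x) = 2 * cos (real (Suc n) * x) * cos x"
      by (simp only:)
    moreover have "a + b = 2 * c * k \<Longrightarrow> 2 * k * c - b = a" for a b c k :: real
      by (simp add: algebra_simps)
    ultimately have "2 * cos x * cos (real (Suc n) * x) - cos (real n * x) = cos (real (Suc (Suc n)) * x)"
      by blast
    then show ?thesis using p(2) q(2) by simp
  qed
  ultimately show ?case by blast
qed

lemma cos_diff_bound: "\<bar>cos x - cos y\<bar> \<le> \<bar>x - y\<bar>" for x y :: real
proof -
  have "\<bar>cos x - cos y\<bar> = 2 * \<bar>sin ((x + y) / 2)\<bar> * \<bar>sin ((y - x) / 2)\<bar>"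
    by (simp add: cos_diff_cos abs_mult)
  also have "\<dots> \<le> 2 * 1 * \<bar>(y - x) / 2\<bar>"
    by (intro mult_mono abs_sin_x_le_abs_x) auto
  finally show ?thesis by simp
qed

lemma eventually_abs_sin_ge: "\<forall>\<^sub>F u in nhds (0::real). \<bar>sin u\<bar> \<ge> \<bar>u\<bar> / 2"
proof -
  have "((\<lambda>u. sin u / u) \<longlongrightarrow> 1) (at (0::real))"
    using DERIV_sin[of "0::real"] by (simp add: DERIV_def)
  then have "\<forall>\<^sub>F u in at (0::real). sin u / u > 1 / 2" by (rule order_tendstoD) simp
  then have "\<forall>\<^sub>F u in at (0::real). \<bar>sin u\<bar> \<ge> \<bar>u\<bar> / 2"
  proof (rule eventually_mono)
    fix u :: real assume u: "sin u / u > 1 / 2"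
    then have "\<bar>sin u / u\<bar> > 1 / 2" using abs_ge_self[of "sin u / u"] by linarith
    then have "\<bar>sin u\<bar> / \<bar>u\<bar> > 1 / 2" by (simp only: abs_divide)
    then show "\<bar>sin u\<bar> \<ge> \<bar>u\<bar> / 2" by (cases "u = 0") (auto simp: field_simps)
  qed
  then show ?thesis by (simp add: eventually_nhds_conv_at)
qed

text \<open>With \<open>w = cos x\<close>, \<open>y = pi * j / d\<close> and
  \<open>u = d * (x - y) / 2\<close> the left side is \<open>2 * (sin u)^2\<close>. Since the
  distance of \<open>w\<close> from \<open>cos y\<close> is at most
  \<open>2 * \<bar>u\<bar> \<le> 4 * \<bar>sin u\<bar>\<close>, the constant is 2/16. The values
  \<open>j = 0\<close> and \<open>j = d\<close> are excluded because they give the end points 1 and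
  -1, where \<open>T_d\<close> is not critical.\<close>

lemma chebyshev_growth:
  fixes q :: "real poly"
  assumes q: "\<And>x. poly q (cos x) = cos (real d * x)" and j: "0 < j" "j < d"
  shows "\<forall>\<^sub>F w in nhds (cos (pi * j / d)). 1 - (-1) ^ j * poly q w \<ge> 1 / 8 * (w - cos (pi * j / d))\<^sup>2"
proof -
  define y where "y = pi * j / d"
  have y: "0 < y" "y < pi" using j by (auto simp: y_def field_simps)
  have w: "-1 < cos y" "cos y < 1"
    using cos_monotone_0_pi[of 0 y] cos_monotone_0_pi[of y pi] y by simp_all
  have yy: "arccos (cos y) = y" using y by (intro arccos_cos) auto
  have "isCont (\<lambda>w. d * (arccos w - y) / 2) (cos y)"
    using isCont_arccos[OF w] by (intro continuous_intros) auto
  then have "((\<lambda>w. d * (arccos w - y) / 2) \<longlongrightarrow> 0) (nhds (cos y))"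
    using yy by (simp add: isCont_def tendsto_nhds_iff)
  then have ev: "\<forall>\<^sub>F w in nhds (cos y). \<bar>sin (d * (arccos w - y) / 2)\<bar> \<ge> \<bar>d * (arccos w - y) / 2\<bar> / 2"
    by (rule eventually_compose_filterlim[OF eventually_abs_sin_ge])
  have "\<forall>\<^sub>F w in nhds (cos y). w \<in> {-1<..<1}" using w by (intro eventually_nhds_in_open) auto
  with ev show ?thesis unfolding y_def[symmetric]
  proof eventually_elim
    case (elim w)
    define x where "x = arccos w"
    have wx: "w = cos x" using elim(2) by (simp add: x_def cos_arccos)
    define u where "u = d * (x - y) / 2"
    have "cos (d * x) * (-1) ^ j = cos (d * x - pi * j)"
      by (simp add: cos_diff cos_npi mult.commute[of pi])
    also have "d * x - pi * j = 2 * u" using j by (simp add: u_def y_def field_simps)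
    finally have "cos (d * x) * (-1) ^ j = 1 - 2 * (sin u)\<^sup>2" by (simp only: cos_double_sin)
    then have e: "1 - (-1) ^ j * poly q w = 2 * (sin u)\<^sup>2" by (simp add: wx q mult.commute)
    have "\<bar>w - cos y\<bar> \<le> \<bar>x - y\<bar>" unfolding wx by (rule cos_diff_bound)
    also have "\<dots> \<le> 2 * \<bar>u\<bar>"
    proof -
      have "1 * \<bar>x - y\<bar> \<le> real d * \<bar>x - y\<bar>" using j by (intro mult_right_mono) auto
      then show ?thesis by (simp add: u_def abs_mult)
    qed
    also have "\<bar>u\<bar> \<le> 2 * \<bar>sin u\<bar>" using elim(1) by (simp add: u_def x_def)
    finally have "\<bar>w - cos y\<bar> \<le> \<bar>4 * sin u\<bar>" by (simp add: abs_mult)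
    then have "(w - cos y)\<^sup>2 \<le> (4 * sin u)\<^sup>2" by (simp only: abs_le_square_iff)
    then show "1 / 8 * (w - cos y)\<^sup>2 \<le> 1 - (-1) ^ j * poly q w" unfolding e by (simp add: power_mult_distrib)
  qed
qed

lemma chebyshev_value:
  assumes "\<And>x. poly q (cos x) = cos (real d * x)" "0 < d"
  shows "poly q (cos (pi * j / d)) = (-1) ^ j"
proof -
  have "poly q (cos (pi * real j / d)) = cos (pi * real j)" unfolding assms(1) using assms(2) by simp
  then show ?thesis by (simp add: cos_npi mult.commute[of pi])
qed

section \<open>The surface\<close>

lemma eval4_superset:
  assumes "finite K" "Poly_Mapping.keys F \<subseteq> K"
  shows "eval4 F x = (\<Sum>m\<in>K. Poly_Mapping.lookup F m * (\<Prod>i\<in>UNIV. (x $ i) ^ Poly_Mapping.lookup m i))"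
  unfolding eval4_def using assms by (intro sum.mono_neutral_left) (auto simp: in_keys_iff)

lemma eval4_add: "eval4 (F + G) x = eval4 F x + eval4 G x"
proof -
  let ?K = "Poly_Mapping.keys F \<union> Poly_Mapping.keys G"
  have "eval4 (F + G) x = (\<Sum>m\<in>?K. Poly_Mapping.lookup (F + G) m * (\<Prod>i\<in>UNIV. (x $ i) ^ Poly_Mapping.lookup m i))"
    by (rule eval4_superset) (use Poly_Mapping.keys_add[of F G] in auto)
  moreover have "eval4 F x = (\<Sum>m\<in>?K. Poly_Mapping.lookup F m * (\<Prod>i\<in>UNIV. (x $ i) ^ Poly_Mapping.lookup m i))"
    "eval4 G x = (\<Sum>m\<in>?K. Poly_Mapping.lookup G m * (\<Prod>i\<in>UNIV. (x $ i) ^ Poly_Mapping.lookup m i))"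
    by (auto intro!: eval4_superset)
  ultimately show ?thesis by (simp add: lookup_add distrib_right sum.distrib)
qed

text \<open>Forms are handled through their value functions, so that a surface can be assembled from
  monomials without tracking its coefficients.\<close>

definition form4 :: "nat \<Rightarrow> (real^4 \<Rightarrow> real) \<Rightarrow> bool" where
  "form4 d \<phi> \<longleftrightarrow> (\<exists>F. homogeneous4 d F \<and> (\<forall>x. eval4 F x = \<phi> x))"

lemma form4_0: "form4 d (\<lambda>x. 0)"
  unfolding form4_def by (intro exI[of _ 0]) (simp add: homogeneous4_def eval4_def)

lemma form4_add:
  assumes "form4 d f" "form4 d g"
  shows "form4 d (\<lambda>x. f x + g x)"
proof -
  obtain F G where FG: "homogeneous4 d F" "\<And>x. eval4 F x = f x" "homogeneous4 d G" "\<And>x. eval4 G x = g x"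
    using assms unfolding form4_def by blast
  have "homogeneous4 d (F + G)"
    using FG(1,3) Poly_Mapping.keys_add[of F G] unfolding homogeneous4_def by blast
  then show ?thesis unfolding form4_def by (intro exI[of _ "F + G"]) (simp add: eval4_add FG)
qed

lemma form4_sum:
  assumes "finite A" "\<And>a. a \<in> A \<Longrightarrow> form4 d (f a)"
  shows "form4 d (\<lambda>x. \<Sum>a\<in>A. f a x)"
  using assms
proof (induction A)
  case (insert a A)
  then show ?case using form4_add[of d "f a"] by simp
qed (simp add: form4_0)

lemma prod_4: "prod f (UNIV :: 4 set) = f 1 * f 2 * f 3 * f 4" for f :: "4 \<Rightarrow> 'a::comm_monoid_mult"
  unfolding UNIV_4 by (simp add: mult_ac)

lemma form4_monomial:
  assumes "a + b + c + e = d"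
  shows "form4 d (\<lambda>x. k * (x$1 ^ a * x$2 ^ b * x$3 ^ c * x$4 ^ e))"
proof -
  define m :: "4 \<Rightarrow>\<^sub>0 nat" where
    "m = Poly_Mapping.single 1 a + Poly_Mapping.single 2 b + Poly_Mapping.single 3 c + Poly_Mapping.single 4 e"
  have m: "Poly_Mapping.lookup m 1 = a" "Poly_Mapping.lookup m 2 = b" "Poly_Mapping.lookup m 3 = c" "Poly_Mapping.lookup m 4 = e"
    by (simp_all add: m_def lookup_add lookup_single when_def)
  define F where "F = Poly_Mapping.single m k"
  have keys: "Poly_Mapping.keys F \<subseteq> {m}" by (simp add: F_def)
  have "homogeneous4 d F"
    using keys assms unfolding homogeneous4_def by (auto simp: sum_4 m)
  moreover have "eval4 F x = k * (x$1 ^ a * x$2 ^ b * x$3 ^ c * x$4 ^ e)" for x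
    by (subst eval4_superset[OF _ keys]) (simp_all add: F_def prod_4 m)
  ultimately show ?thesis unfolding form4_def by blast
qed

lemma homogenize_plane_and_height:
  assumes h: "plane_poly d h" and q: "degree q \<le> d"
  obtains F where "homogeneous4 d F" "\<And>a. a $ 4 = 1 \<Longrightarrow> eval4 F a = h (a $ 1, a $ 2) + poly q (a $ 3)"
proof -
  obtain c where c: "\<And>i j. i + j > d \<Longrightarrow> c i j = 0" "\<And>x y. h (x, y) = (\<Sum>i\<le>d. \<Sum>j\<le>d. c i j * x ^ i * y ^ j)"
    using h unfolding plane_poly_def by blast
  have T: "form4 d (\<lambda>x. c i j * (x$1 ^ i * x$2 ^ j * x$3 ^ 0 * x$4 ^ (d - i - j)))" for i j
  proof (cases "i + j \<le> d")
    case True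
    then show ?thesis by (intro form4_monomial) simp
  next
    \<comment> \<open>Here the exponent of the fourth variable is truncated to 0 and the degree
      would be wrong, but the coefficient vanishes.\<close>
    case False
    then show ?thesis using c(1)[of i j] by (simp add: form4_0)
  qed
  have "form4 d (\<lambda>x. \<Sum>i\<le>d. \<Sum>j\<le>d. c i j * (x$1 ^ i * x$2 ^ j * x$3 ^ 0 * x$4 ^ (d - i - j)))"
    by (rule form4_sum, simp, rule form4_sum, simp, rule T)
  moreover have "form4 d (\<lambda>x. \<Sum>k\<le>d. coeff q k * (x$1 ^ 0 * x$2 ^ 0 * x$3 ^ k * x$4 ^ (d - k)))"
    by (rule form4_sum, simp, rule form4_monomial, simp)
  ultimately have "form4 d (\<lambda>x. (\<Sum>i\<le>d. \<Sum>j\<le>d. c i j * (x$1 ^ i * x$2 ^ j * x$3 ^ 0 * x$4 ^ (d - i - j))) +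
      (\<Sum>k\<le>d. coeff q k * (x$1 ^ 0 * x$2 ^ 0 * x$3 ^ k * x$4 ^ (d - k))))"
    by (rule form4_add)
  then obtain F where F: "homogeneous4 d F" "\<And>x. eval4 F x = (\<Sum>i\<le>d. \<Sum>j\<le>d. c i j * (x$1 ^ i * x$2 ^ j * x$3 ^ 0 * x$4 ^ (d - i - j))) +
      (\<Sum>k\<le>d. coeff q k * (x$1 ^ 0 * x$2 ^ 0 * x$3 ^ k * x$4 ^ (d - k)))"
    unfolding form4_def by blast
  have "eval4 F a = h (a $ 1, a $ 2) + poly q (a $ 3)" if "a $ 4 = 1" for a
    unfolding F(2) c(2) poly_eq_sum_le[OF q] using that by (simp add: mult.assoc)
  then show ?thesis using that F(1) by blast
qed

text \<open>A solitary point is defined through the polynomials along lines, so growth along each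
  line is enough, and \<open>m\<close> may depend on the direction.\<close>

lemma solitary_pointI:
  assumes \<sigma>: "\<sigma> = 1 \<or> \<sigma> = (-1::real)" and a: "a $ i = 1" "a \<in> L" "eval4 F a = 0"
    and growth: "\<And>h. h $ i = 0 \<Longrightarrow> h \<noteq> 0 \<Longrightarrow> \<exists>m>0. \<forall>\<^sub>F s in at 0. \<sigma> * eval4 F (a + s *\<^sub>R h) \<ge> m * s\<^sup>2"
  shows "solitary_point F L"
proof -
  have "coeff (line_poly F a h) 1 = 0 \<and> \<sigma> * coeff (line_poly F a h) 2 > 0" if h: "h $ i = 0" "h \<noteq> 0" for h
  proof -
    obtain m where m: "m > 0" "\<forall>\<^sub>F s in at 0. \<sigma> * eval4 F (a + s *\<^sub>R h) \<ge> m * s\<^sup>2"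
      using growth[OF h] by blast
    have "poly (smult \<sigma> (line_poly F a h)) 0 = 0" by (simp add: poly_line_poly a(3))
    moreover have "\<forall>\<^sub>F s in at 0. poly (smult \<sigma> (line_poly F a h)) s \<ge> m * s\<^sup>2"
      using m(2) by (simp add: poly_line_poly)
    ultimately have "coeff (smult \<sigma> (line_poly F a h)) 1 = 0" "coeff (smult \<sigma> (line_poly F a h)) 2 > 0"
      using poly_quadratic_growth[OF _ m(1)] by blast+
    then show ?thesis using \<sigma> by auto
  qed
  \<comment> \<open>The condition on the linear part includes the direction 0, about which the
    growth hypothesis says nothing.\<close>
  moreover have "coeff (line_poly F a 0) 1 = 0"
  proof -
    have "poly (line_poly F a 0) = poly 0" by (rule ext) (simp add: poly_line_poly a(3))
    then have "line_poly F a 0 = 0" by (simp only: poly_eq_poly_eq_iff)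
    then show ?thesis by simp
  qed
  ultimately have "(\<forall>h. h $ i = 0 \<longrightarrow> hom_part F a 1 h = 0)"
    and "\<forall>h. h $ i = 0 \<and> h \<noteq> 0 \<longrightarrow> \<sigma> * hom_part F a 2 h > 0"
    unfolding hom_part_def by metis+
  then show ?thesis unfolding solitary_point_def using a \<sigma> by (intro exI[of _ i] exI[of _ a]) auto
qed

lemma span_singleton_RP3:
  assumes "a $ (4::4) = (1::real)"
  shows "span {a} \<in> RP3"
proof -
  have "a \<noteq> 0" using assms by auto
  then show ?thesis by (simp add: RP3_def dim_span)
qed

lemma span_singleton_inj:
  assumes "a $ (4::4) = (1::real)" "b $ 4 = 1" "span {a} = span {b}"
  shows "a = b"
proof -
  have "a \<in> span {b}" using assms(3) span_base[of a "{a}"] by simp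
  then obtain k where "a = k *\<^sub>R b" by (auto simp: span_singleton)
  then show ?thesis using assms(1,2) by simp
qed

text \<open>The perturbation result applied to the curve, with the interpolation polynomials as dual
  functions. Dividing by the common size of the extremal values normalizes them to 1 and -1,
  matching the critical values of \<open>T_d\<close>.\<close>

lemma plane_polynomial_with_prescribed_extrema:
  assumes d: "d \<ge> 3"
  obtains h \<sigma> x m where "plane_poly d h" "m > 0" "inj_on x (node_index d)"
    "\<And>p. p \<in> node_index d \<Longrightarrow> \<sigma> p = 1 \<or> \<sigma> p = (-1::real)"
    "\<And>p. p \<in> node_index d \<Longrightarrow> h (x p) = \<sigma> p"
    "\<And>p. p \<in> node_index d \<Longrightarrow> \<forall>\<^sub>F y in nhds (x p). \<sigma> p * h y \<ge> 1 + m * (norm (x p - y))\<^sup>2"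
    "\<And>a b. even d \<Longrightarrow> (a, b) \<in> node_index d \<Longrightarrow> odd a \<or> odd b \<Longrightarrow> \<sigma> (a, b) = 1"
proof -
  have d1: "d \<ge> 1" using d by simp
  obtain f where f: "plane_poly d f"
    "\<And>t X Y. t ^ d = of_real X \<Longrightarrow> f (X, Y) = Re (\<Prod>z | z ^ d = 1. (1 - z * t) ^ d - of_real Y)"
    by (rule fermat_curve_real[OF d1]) (rule that)
  obtain H where H: "has_hessian f H" "continuous_on UNIV f"
    by (rule plane_poly_hessian[OF f(1)]) (rule that)
  let ?I = "node_index d" and ?P = "node_point d"
  have "\<exists>s. (s = 1 \<or> s = (-1::real)) \<and> f (?P p) = 0 \<and> (\<forall>\<^sub>F x in nhds (?P p). s * f x \<ge> 0) \<and>
      (\<forall>v. v \<noteq> 0 \<longrightarrow> s * H (?P p) v > 0) \<and> (even d \<longrightarrow> odd (fst p) \<or> odd (snd p) \<longrightarrow> s = 1)" if p: "p \<in> ?I" for p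
  proof -
    have e: "(fst (?P p), snd (?P p)) = ?P p" by simp
    obtain s where s: "s = 1 \<or> s = (-1::real)" "f (fst (?P p), snd (?P p)) = 0"
      "\<forall>\<^sub>F x in nhds (fst (?P p), snd (?P p)). s * f x \<ge> 0"
      "\<And>v. v \<noteq> 0 \<Longrightarrow> s * H (fst (?P p), snd (?P p)) v > 0"
      "even d \<Longrightarrow> fst (?P p) < 0 \<or> snd (?P p) < 0 \<Longrightarrow> s = 1"
      by (rule fermat_node[OF d1 _ H(1) node_param_props[OF p]], erule f(2), rule that)
    have "fst (?P p) < 0 \<or> snd (?P p) < 0" if "odd (fst p) \<or> odd (snd p)"
      using node_point_neg[of "fst p" "snd p" d] p that by simp
    then show ?thesis using s unfolding e by blast
  qed
  then have "\<forall>p. \<exists>s. p \<in> ?I \<longrightarrow> (s = 1 \<or> s = (-1::real)) \<and> f (?P p) = 0 \<and> (\<forall>\<^sub>F x in nhds (?P p). s * f x \<ge> 0) \<and>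
      (\<forall>v. v \<noteq> 0 \<longrightarrow> s * H (?P p) v > 0) \<and> (even d \<longrightarrow> odd (fst p) \<or> odd (snd p) \<longrightarrow> s = 1)" by blast
  from choice[OF this] obtain \<sigma> where "\<forall>p. p \<in> ?I \<longrightarrow> (\<sigma> p = 1 \<or> \<sigma> p = (-1::real)) \<and> f (?P p) = 0 \<and>
      (\<forall>\<^sub>F x in nhds (?P p). \<sigma> p * f x \<ge> 0) \<and> (\<forall>v. v \<noteq> 0 \<longrightarrow> \<sigma> p * H (?P p) v > 0) \<and>
      (even d \<longrightarrow> odd (fst p) \<or> odd (snd p) \<longrightarrow> \<sigma> p = 1)" ..
  then have \<sigma>: "\<sigma> p = 1 \<or> \<sigma> p = -1" "f (?P p) = 0" "\<forall>\<^sub>F x in nhds (?P p). \<sigma> p * f x \<ge> 0"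
    "v \<noteq> 0 \<Longrightarrow> \<sigma> p * H (?P p) v > 0" "even d \<Longrightarrow> odd (fst p) \<or> odd (snd p) \<Longrightarrow> \<sigma> p = 1" if "p \<in> ?I" for p v
    using that by blast+
  have "\<forall>q. \<exists>g. q \<in> ?I \<longrightarrow> plane_poly d g \<and> (\<forall>p\<in>?I. g (?P p) = (if p = q then 1 else 0))"
    using node_interpolation[OF d] plane_poly_mono[of "d - 3" _ d] by (meson diff_le_self)
  from choice[OF this] obtain g where
    "\<forall>q. q \<in> ?I \<longrightarrow> plane_poly d (g q) \<and> (\<forall>p\<in>?I. g q (?P p) = (if p = q then 1 else 0))" ..
  then have g: "plane_poly d (g q)" "p \<in> ?I \<Longrightarrow> g q (?P p) = (if p = q then 1 else 0)" if "q \<in> ?I" for p q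
    using that by blast+
  have "\<forall>q. \<exists>H. q \<in> ?I \<longrightarrow> has_hessian (g q) H \<and> continuous_on UNIV (g q)"
    using g(1) plane_poly_hessian by metis
  from choice[OF this] obtain Hg where
    "\<forall>q. q \<in> ?I \<longrightarrow> has_hessian (g q) (Hg q) \<and> continuous_on UNIV (g q)" ..
  then have Hg: "has_hessian (g q) (Hg q)" "continuous_on UNIV (g q)" if "q \<in> ?I" for q using that by blast+
  \<comment> \<open>The perturbation result indexes its points by an initial segment of
    \<open>nat\<close>; \<open>k\<close> enumerates the nodes and \<open>l\<close> below inverts
    it.\<close>
  define n where "n = card ?I"
  obtain k where k: "bij_betw k {..<n} ?I"
    using ex_bij_betw_nat_finite[OF finite_node_index[of d]] unfolding n_def atLeast0LessThan by blast
  have kI: "k i \<in> ?I" if "i < n" for i using k that by (auto simp: bij_betw_def)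
  have kinj: "k i = k j \<longleftrightarrow> i = j" if "i < n" "j < n" for i j
    using k that by (auto simp: bij_betw_def inj_on_def)
  have inj: "inj_on (\<lambda>i. ?P (k i)) {..<n}"
  proof (rule inj_onI)
    fix i j assume ij: "i \<in> {..<n}" "j \<in> {..<n}" "?P (k i) = ?P (k j)"
    then have "k i = k j" by (intro inj_onD[OF inj_on_node_point[of d]] kI) auto
    then show "i = j" using kinj ij by simp
  qed
  have "\<exists>e c x m. e > 0 \<and> m > 0 \<and> inj_on x {..<n} \<and>
    (\<forall>i<n. f (x i) + (\<Sum>j<n. c j * g (k j) (x i)) = e * \<sigma> (k i) \<and>
       (\<forall>\<^sub>F y in nhds (x i). \<sigma> (k i) * (f y + (\<Sum>j<n. c j * g (k j) y)) \<ge> e + m * (norm (x i - y))\<^sup>2))"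
    by (rule prescribe_extremal_values[OF H(1) _ inj _ _ _ _ _ H(2), where Hg = "\<lambda>j. Hg (k j)"])
      (use Hg \<sigma> g kI kinj in \<open>simp_all\<close>)
  then obtain e c x m where e: "e > 0" and m: "m > 0" and x: "inj_on x {..<n}"
    "\<And>i. i < n \<Longrightarrow> f (x i) + (\<Sum>j<n. c j * g (k j) (x i)) = e * \<sigma> (k i)"
    "\<And>i. i < n \<Longrightarrow> \<forall>\<^sub>F y in nhds (x i). \<sigma> (k i) * (f y + (\<Sum>j<n. c j * g (k j) y)) \<ge> e + m * (norm (x i - y))\<^sup>2"
    by blast
  define h where "h = (\<lambda>y. 1 / e * (f y + (\<Sum>j<n. c j * g (k j) y)))"
  define l where "l = the_inv_into {..<n} k"
  have l: "l p < n" "k (l p) = p" if "p \<in> ?I" for p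
    using that k f_the_inv_into_f_bij_betw[OF k] the_inv_into_into[of k "{..<n}" p "{..<n}"]
    by (auto simp: l_def bij_betw_def)
  show ?thesis
  proof (rule that[of h "m / e" "\<lambda>p. x (l p)" \<sigma>])
    show "plane_poly d h"
      unfolding h_def by (intro plane_poly_cmult plane_poly_add f(1) plane_poly_sum g(1) kI) auto
    show "m / e > 0" using m e by simp
    show "inj_on (\<lambda>p. x (l p)) ?I"
    proof (rule inj_onI)
      fix p q assume pq: "p \<in> ?I" "q \<in> ?I" "x (l p) = x (l q)"
      then have "l p = l q" using inj_onD[OF x(1), of "l p" "l q"] l by auto
      then show "p = q" using l pq by metis
    qed
    show "\<sigma> p = 1 \<or> \<sigma> p = -1" if "p \<in> ?I" for p using \<sigma>(1)[OF that] .
    show "h (x (l p)) = \<sigma> p" if "p \<in> ?I" for p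
      unfolding h_def x(2)[OF l(1)[OF that]] using e l(2)[OF that] by simp
    show "\<forall>\<^sub>F y in nhds (x (l p)). \<sigma> p * h y \<ge> 1 + m / e * (norm (x (l p) - y))\<^sup>2" if "p \<in> ?I" for p
      using x(3)[OF l(1)[OF that]]
    proof (rule eventually_mono)
      fix y assume "e + m * (norm (x (l p) - y))\<^sup>2 \<le> \<sigma> (k (l p)) * (f y + (\<Sum>j<n. c j * g (k j) y))"
      from divide_right_mono[OF this less_imp_le[OF e]]
      have "(e + m * (norm (x (l p) - y))\<^sup>2) / e \<le> \<sigma> p * h y" by (simp add: h_def l(2)[OF that])
      then show "\<sigma> p * h y \<ge> 1 + m / e * (norm (x (l p) - y))\<^sup>2"
        using e by (simp add: add_divide_distrib)
    qed
    show "\<sigma> (a, b) = 1" if "even d" "(a, b) \<in> ?I" "odd a \<or> odd b" for a b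
      using \<sigma>(5)[OF that(2,1)] that(3) by simp
  qed
qed

text \<open>Over the node \<open>p\<close> and at level \<open>j\<close> the two summands have
  values \<open>\<sigma> p\<close> and \<open>(-1)^j\<close>, which must cancel. The same condition
  gives both extrema the same type, so their growth estimates add up.\<close>

lemma surface_with_solitary_points:
  assumes d: "d \<ge> 3"
  obtains F \<sigma> where "F \<in> real_surfaces d"
    "\<And>a b. even d \<Longrightarrow> (a, b) \<in> node_index d \<Longrightarrow> odd a \<or> odd b \<Longrightarrow> \<sigma> (a, b) = 1"
    "\<And>p. p \<in> node_index d \<Longrightarrow> \<sigma> p = 1 \<or> \<sigma> p = (-1::real)"
    "ecard (solitary_points F) \<ge> enat (card {(p, j). p \<in> node_index d \<and> 0 < j \<and> j < d \<and> (-1) ^ j = - \<sigma> p})"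
proof -
  obtain h \<sigma> x m where h: "plane_poly d h" "m > 0" "inj_on x (node_index d)"
    "\<And>p. p \<in> node_index d \<Longrightarrow> \<sigma> p = 1 \<or> \<sigma> p = (-1::real)"
    "\<And>p. p \<in> node_index d \<Longrightarrow> h (x p) = \<sigma> p"
    "\<And>p. p \<in> node_index d \<Longrightarrow> \<forall>\<^sub>F y in nhds (x p). \<sigma> p * h y \<ge> 1 + m * (norm (x p - y))\<^sup>2"
    "\<And>a b. even d \<Longrightarrow> (a, b) \<in> node_index d \<Longrightarrow> odd a \<or> odd b \<Longrightarrow> \<sigma> (a, b) = 1"
    by (rule plane_polynomial_with_prescribed_extrema[OF d]) (rule that)
  obtain q :: "real poly" where q: "degree q \<le> d" "\<And>x. poly q (cos x) = cos (real d * x)"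
    using chebyshev_exists[of d] by blast
  obtain F where F: "homogeneous4 d F" "\<And>a. a $ 4 = 1 \<Longrightarrow> eval4 F a = h (a $ 1, a $ 2) + poly q (a $ 3)"
    by (rule homogenize_plane_and_height[OF h(1) q(1)]) (rule that)
  define pt :: "(real \<times> real) \<Rightarrow> real \<Rightarrow> real^4" where "pt = (\<lambda>y w. \<chi> i. if i = 1 then fst y else if i = 2 then snd y else if i = 3 then w else 1)"
  have pt: "pt y w $ 1 = fst y" "pt y w $ 2 = snd y" "pt y w $ 3 = w" "pt y w $ 4 = 1" for y w
    by (simp_all add: pt_def)
  \<comment> \<open>On the vertical line over the origin \<open>F\<close> is a constant plus
    \<open>T_d\<close>, which takes the two values 1 and -1.\<close>
  have F0: "F \<noteq> 0"
  proof
    assume "F = 0"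
    then have "eval4 F a = 0" for a by (simp add: eval4_def)
    then have "h 0 + poly q w = 0" for w using F(2)[of "pt 0 w"] by (simp add: pt zero_prod_def)
    then have "poly q (cos 0) = poly q (cos (pi / d))" by (metis add_left_cancel)
    then show False unfolding q(2) using d by simp
  qed
  define lv where "lv = (\<lambda>j::nat. cos (pi * j / d))"
  define J where "J = {(p, j). p \<in> node_index d \<and> 0 < j \<and> j < d \<and> (-1) ^ j = - \<sigma> p}"
  define P where "P = (\<lambda>(p, j). span {pt (x p) (lv j)})"
  have "inj_on P J"
  proof (rule inj_onI)
    fix u v assume uv: "u \<in> J" "v \<in> J" "P u = P v"
    obtain p i where u: "u = (p, i)" by fastforce
    obtain r j where v: "v = (r, j)" by fastforce
    have e: "pt (x p) (lv i) = pt (x r) (lv j)"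
      using uv(3) by (intro span_singleton_inj) (auto simp: u v P_def pt)
    have "x p = x r"
      using arg_cong[OF e, of "\<lambda>a. a $ 1"] arg_cong[OF e, of "\<lambda>a. a $ 2"] by (simp add: pt prod_eq_iff)
    have "lv i = lv j" using arg_cong[OF e, of "\<lambda>a. a $ 3"] by (simp add: pt)
    have J: "p \<in> node_index d" "r \<in> node_index d" "i < d" "j < d" using uv(1,2) by (simp_all add: u v J_def)
    have "p = r" by (rule inj_onD[OF h(3) \<open>x p = x r\<close> J(1,2)])
    moreover have angle: "0 \<le> pi * real k / d" "pi * real k / d \<le> pi" if "k < d" for k
      using that by (simp_all add: divide_le_eq)
    have "pi * i / d = pi * j / d"
      by (rule cos_inj_pi[OF angle[OF J(3)] angle[OF J(4)] \<open>lv i = lv j\<close>[unfolded lv_def]])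
    then have "i = j" using d by simp
    ultimately show "u = v" by (simp add: u v)
  qed
  moreover have "P ` J \<subseteq> solitary_points F"
  proof
    fix L assume "L \<in> P ` J"
    then obtain p j where pj: "p \<in> node_index d" "0 < j" "j < d" "(-1) ^ j = - \<sigma> p" and L: "L = span {pt (x p) (lv j)}"
      by (auto simp: P_def J_def)
    define a where "a = pt (x p) (lv j)"
    have qj: "poly q (lv j) = - \<sigma> p" unfolding lv_def using chebyshev_value[OF q(2), of j] d pj(4) by simp
    have "solitary_point F L"
    proof (rule solitary_pointI[OF h(4)[OF pj(1)], where i = 4 and a = a])
      show "a $ 4 = 1" "a \<in> L" by (simp_all add: a_def pt L span_base)
      show "eval4 F a = 0" using F(2)[of a] qj h(5)[OF pj(1)] by (simp add: a_def pt)
      fix v :: "real^4" assume v: "v $ 4 = 0" "v \<noteq> 0"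
      define y where "y = (v $ 1, v $ 2)"
      \<comment> \<open>The growth constants of \<open>h\<close> and of \<open>T_d\<close>, weighted
        by the horizontal and vertical parts of \<open>v\<close>; one of these parts is
        nonzero.\<close>
      define \<mu> where "\<mu> = m * (norm y)\<^sup>2 + 1 / 8 * (v $ 3)\<^sup>2"
      have ev: "eval4 F (a + s *\<^sub>R v) = h (x p + s *\<^sub>R y) + poly q (lv j + s * v $ 3)" for s
      proof -
        have "(fst (x p) + s * v $ 1, snd (x p) + s * v $ 2) = x p + s *\<^sub>R y" by (simp add: y_def prod_eq_iff)
        then show ?thesis using F(2)[of "a + s *\<^sub>R v"] v(1) by (simp add: a_def pt)
      qed
      have "\<mu> > 0"
      proof (cases "v $ 3 = 0")
        case True
        then have "y \<noteq> 0" using v by (auto simp: y_def zero_prod_def vec_eq_iff forall_4)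
        then show ?thesis using h(2) True by (simp add: \<mu>_def)
      next
        case False
        then have "1 / 8 * (v $ 3)\<^sup>2 > 0" by simp
        moreover have "m * (norm y)\<^sup>2 \<ge> 0" using h(2) by simp
        ultimately show ?thesis unfolding \<mu>_def by linarith
      qed
      moreover have "\<forall>\<^sub>F s in at 0. \<mu> * s\<^sup>2 \<le> \<sigma> p * eval4 F (a + s *\<^sub>R v)"
      proof -
        have lim: "((\<lambda>s. x p + s *\<^sub>R y) \<longlongrightarrow> x p) (at 0)" "((\<lambda>s. lv j + s * v $ 3) \<longlongrightarrow> lv j) (at 0)"
          by (auto intro!: tendsto_eq_intros)
        have "\<forall>\<^sub>F s in at 0. \<sigma> p * h (x p + s *\<^sub>R y) \<ge> 1 + m * (norm (x p - (x p + s *\<^sub>R y)))\<^sup>2"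
          by (rule eventually_compose_filterlim[OF h(6)[OF pj(1)] lim(1)])
        moreover have cheb: "\<forall>\<^sub>F w in nhds (lv j). 1 - (-1) ^ j * poly q w \<ge> 1 / 8 * (w - lv j)\<^sup>2"
          unfolding lv_def by (rule chebyshev_growth[OF q(2) pj(2,3)])
        have "\<forall>\<^sub>F s in at 0. 1 - (-1) ^ j * poly q (lv j + s * v $ 3) \<ge> 1 / 8 * ((lv j + s * v $ 3) - lv j)\<^sup>2"
          by (rule eventually_compose_filterlim[OF cheb lim(2)])
        ultimately show ?thesis
        proof eventually_elim
          case (elim s)
          have "\<mu> * s\<^sup>2 = m * (norm (x p - (x p + s *\<^sub>R y)))\<^sup>2 + 1 / 8 * ((lv j + s * v $ 3) - lv j)\<^sup>2"
            by (simp add: \<mu>_def power_mult_distrib algebra_simps)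
          \<comment> \<open>The extremal values cancel: as \<open>(-1)^j = - \<sigma> p\<close>, the
            two constants 1 disappear and the remaining terms form \<open>\<sigma> p\<close> times
            \<open>F\<close>.\<close>
          also have "\<dots> \<le> (\<sigma> p * h (x p + s *\<^sub>R y) - 1) + (1 - (-1) ^ j * poly q (lv j + s * v $ 3))"
            using elim by linarith
          also have "\<dots> = \<sigma> p * eval4 F (a + s *\<^sub>R v)" unfolding ev pj(4) by (simp add: algebra_simps)
          finally show ?case .
        qed
      qed
      ultimately show "\<exists>\<mu>>0. \<forall>\<^sub>F s in at 0. \<mu> * s\<^sup>2 \<le> \<sigma> p * eval4 F (a + s *\<^sub>R v)" by blast
    qed
    then show "L \<in> solitary_points F"
      using span_singleton_RP3[of a] by (simp add: solitary_points_def L a_def pt)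
  qed
  \<comment> \<open>In the infinite case \<open>ecard\<close> is infinite and the bound is
    trivial.\<close>
  ultimately have "finite (solitary_points F) \<Longrightarrow> card J \<le> card (solitary_points F)"
    by (metis card_image card_mono)
  then have "ecard (solitary_points F) \<ge> enat (card J)" by (simp add: ecard_def)
  then show ?thesis
    using F(1) F0 h(4,7) by (intro that[of F \<sigma>]) (auto simp: real_surfaces_def J_def)
qed

section \<open>Counting levels and nodes\<close>

lemma card_odd_below: "card {j. 0 < j \<and> j < d \<and> odd j} = d div 2"
proof -
  have "{j. 0 < j \<and> j < d \<and> odd j} = (\<lambda>i. 2 * i + 1) ` {..<d div 2}"
    by (auto simp: image_iff elim!: oddE)
  then show ?thesis by (simp add: card_image inj_on_def)
qed

lemma card_even_below: "card {j. 0 < j \<and> j < d \<and> even j} = (d - 1) div 2"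
proof -
  have "{j. 0 < j \<and> j < d \<and> even j} = (\<lambda>i. 2 * i + 2) ` {..<(d - 1) div 2}"
  proof (intro equalityI subsetI)
    fix j assume "j \<in> {j. 0 < j \<and> j < d \<and> even j}"
    then show "j \<in> (\<lambda>i. 2 * i + 2) ` {..<(d - 1) div 2}"
      by (intro image_eqI[of _ _ "j div 2 - 1"]) auto
  qed auto
  then show ?thesis by (simp add: card_image inj_on_def)
qed

text \<open>An even multiple of \<open>pi / (2 * k)\<close> is a multiple of \<open>pi / k\<close>,
  so these triangles are the ones that belong to \<open>k\<close>.\<close>

lemma card_even_nodes: "card {(a, b) \<in> node_index (2 * k). even a \<and> even b} = card (node_index k)"
proof -
  have "{(a, b) \<in> node_index (2 * k). even a \<and> even b} = (\<lambda>(a, b). (2 * a, 2 * b)) ` node_index k"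
    by (auto simp: node_index_def image_iff elim!: evenE)
  moreover have "inj_on (\<lambda>(a, b). (2 * a, 2 * b)) (node_index k)" by (auto simp: inj_on_def)
  ultimately show ?thesis by (simp add: card_image)
qed

text \<open>Odd \<open>j\<close> are the minima of \<open>T_d\<close> and go with the minima of
  \<open>h\<close>; even \<open>j\<close> are the interior maxima and go with the maxima.\<close>

lemma card_signed_levels:
  fixes \<sigma> :: "nat \<times> nat \<Rightarrow> real"
  shows "card {(p, j). p \<in> node_index d \<and> 0 < j \<and> j < d \<and> (-1) ^ j = - \<sigma> p} =
    card {p \<in> node_index d. \<sigma> p = 1} * (d div 2) + card {p \<in> node_index d. \<sigma> p = -1} * ((d - 1) div 2)"
proof -
  let ?A = "{p \<in> node_index d. \<sigma> p = 1}" and ?B = "{p \<in> node_index d. \<sigma> p = -1}"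
  have e: "(-1) ^ j = - \<sigma> p \<longleftrightarrow> (if odd j then \<sigma> p = 1 else \<sigma> p = -1)" for j p
  proof (cases "odd j")
    case True
    then have "(-1::real) ^ j = - 1" by simp
    then show ?thesis using True by (simp only: neg_equal_iff_equal eq_commute[of 1 "\<sigma> p"] if_True not_False_eq_True)
  next
    case False
    then have "(-1::real) ^ j = 1" by simp
    then show ?thesis using False by (simp only: equation_minus_iff[of 1 "\<sigma> p"] if_False not_True_eq_False not_not)
  qed
  have levels: "{(p, j). p \<in> node_index d \<and> 0 < j \<and> j < d \<and> (-1) ^ j = - \<sigma> p} =
      ?A \<times> {j. 0 < j \<and> j < d \<and> odd j} \<union> ?B \<times> {j. 0 < j \<and> j < d \<and> even j}"
    (is "?L = ?R")
  proof (intro set_eqI)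
    fix x :: "(nat \<times> nat) \<times> nat"
    obtain p j where x: "x = (p, j)" by fastforce
    show "x \<in> ?L \<longleftrightarrow> x \<in> ?R" unfolding x mem_Collect_eq prod.case e Un_iff mem_Times_iff fst_conv snd_conv
      by (cases "odd j") (simp_all only: if_True if_False not_False_eq_True not_True_eq_False not_not simp_thms conj_ac)
  qed
  have "card ?R = card (?A \<times> {j. 0 < j \<and> j < d \<and> odd j}) + card (?B \<times> {j. 0 < j \<and> j < d \<and> even j})"
  proof (rule card_Un_disjoint)
    have fin: "finite ?A" "finite ?B" by (rule finite_subset[OF _ finite_node_index], blast)+
    show "finite (?A \<times> {j. 0 < j \<and> j < d \<and> odd j})" by (rule finite_cartesian_product[OF fin(1)]) simp
    show "finite (?B \<times> {j. 0 < j \<and> j < d \<and> even j})" by (rule finite_cartesian_product[OF fin(2)]) simp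
    have "?A \<inter> ?B = {}"
    proof (rule Int_emptyI)
      fix p assume "p \<in> ?A" "p \<in> ?B"
      then have "(1::real) = -1" by (metis (mono_tags, lifting) mem_Collect_eq)
      then show False by simp
    qed
    then show "?A \<times> {j. 0 < j \<and> j < d \<and> odd j} \<inter> ?B \<times> {j. 0 < j \<and> j < d \<and> even j} = {}"
      by (simp only: Times_Int_Times Sigma_empty1)
  qed
  then show ?thesis unfolding levels by (simp only: card_cartesian_product card_odd_below card_even_below)
qed

theorem theorem14:
  fixes d :: nat
  assumes "d \<ge> 1"
  shows "(even d \<longrightarrow> ereal_of_enat (mu3_A1_solitary d)
           \<ge> ereal ((real d - 2) * (2 * (real d)^2 - 3 * real d + 4) / 8)) \<and>
         (odd d \<longrightarrow> ereal_of_enat (mu3_A1_solitary d)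
           \<ge> ereal ((real d - 1)^2 * (real d - 2) / 4))"
proof (cases "d \<ge> 3")
  \<comment> \<open>For degrees 1 and 2 the claimed bound is 0.\<close>
  case False
  with assms have "d = 1 \<or> d = 2" by auto
  moreover have "ereal_of_enat (mu3_A1_solitary d) \<ge> ereal 0" by (simp flip: zero_ereal_def)
  ultimately show ?thesis by auto
next
  case True
  obtain F \<sigma> where F: "F \<in> real_surfaces d"
    "\<And>a b. even d \<Longrightarrow> (a, b) \<in> node_index d \<Longrightarrow> odd a \<or> odd b \<Longrightarrow> \<sigma> (a, b) = 1"
    "\<And>p. p \<in> node_index d \<Longrightarrow> \<sigma> p = 1 \<or> \<sigma> p = (-1::real)"
    "ecard (solitary_points F) \<ge> enat (card {(p, j). p \<in> node_index d \<and> 0 < j \<and> j < d \<and> (-1) ^ j = - \<sigma> p})"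
    by (rule surface_with_solitary_points[OF True]) (rule that)
  define n1 n2 where "n1 = card {p \<in> node_index d. \<sigma> p = 1}" and "n2 = card {p \<in> node_index d. \<sigma> p = -1}"
  define M where "M = n1 * (d div 2) + n2 * ((d - 1) div 2)"
  have "enat M \<le> mu3_A1_solitary d"
    using F(4) SUP_upper[OF F(1), of "\<lambda>F. ecard (solitary_points F)"]
    unfolding card_signed_levels M_def n1_def n2_def mu3_A1_solitary_def by (rule order_trans)
  then have "ereal_of_enat (enat M) \<le> ereal_of_enat (mu3_A1_solitary d)" by (simp only: ereal_of_enat_le_iff)
  then have M: "ereal (real M) \<le> ereal_of_enat (mu3_A1_solitary d)" by simp
  have "n1 + n2 = card (node_index d)"
  proof -
    have "node_index d = {p \<in> node_index d. \<sigma> p = 1} \<union> {p \<in> node_index d. \<sigma> p = -1}" using F(3) by blast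
    moreover have "{p \<in> node_index d. \<sigma> p = 1} \<inter> {p \<in> node_index d. \<sigma> p = -1} = {}"
    proof (rule Int_emptyI)
      fix p assume "p \<in> {p \<in> node_index d. \<sigma> p = 1}" "p \<in> {p \<in> node_index d. \<sigma> p = -1}"
      then have "(1::real) = -1" by (metis (mono_tags, lifting) mem_Collect_eq)
      then show False by simp
    qed
    ultimately show ?thesis unfolding n1_def n2_def
      by (metis (no_types, lifting) card_Un_disjoint finite_Un finite_node_index)
  qed
  then have n: "2 * (n1 + n2) = (d - 1) * (d - 2)" by (simp add: card_node_index)
  have d: "real (d - 1) = real d - 1" "real (d - 2) = real d - 2" using True by simp_all
  have nr: "2 * (real n1 + real n2) = (real d - 1) * (real d - 2)"
    using arg_cong[OF n, of real] by (simp only: of_nat_mult of_nat_add of_nat_numeral d)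
  show ?thesis
  proof (intro conjI impI)
    assume "odd d"
    then obtain k where k: "d = 2 * k + 1" by (elim oddE)
    \<comment> \<open>For odd \<open>d\<close> minima and maxima both have \<open>k\<close> levels,
      so the distribution of signs among the nodes does not matter.\<close>
    have "real M = (real n1 + real n2) * real k" by (simp add: M_def k distrib_right)
    also have "\<dots> = (real d - 1)^2 * (real d - 2) / 4"
      using nr by (simp add: k power2_eq_square)
    finally have "real M = (real d - 1)^2 * (real d - 2) / 4" .
    then show "ereal ((real d - 1)^2 * (real d - 2) / 4) \<le> ereal_of_enat (mu3_A1_solitary d)"
      using M by (simp only:)
  next
    assume "even d"
    then obtain k where k: "d = 2 * k" by (elim evenE)
    have "k \<ge> 2" using True k by simp
    \<comment> \<open>For even \<open>d\<close> a maximum has one level fewer than a minimum, so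
      each costs one point and a lower bound for \<open>M\<close> needs an upper bound for their
      number.\<close>
    have "{p \<in> node_index d. \<sigma> p = -1} \<subseteq> {(a, b) \<in> node_index d. even a \<and> even b}"
    proof
      fix p assume p: "p \<in> {p \<in> node_index d. \<sigma> p = -1}"
      obtain a b where ab: "p = (a, b)" by fastforce
      have "\<sigma> (a, b) \<noteq> 1" using p by (simp add: ab)
      then show "p \<in> {(a, b) \<in> node_index d. even a \<and> even b}" using F(2)[OF \<open>even d\<close>, of a b] p by (simp add: ab) blast
    qed
    moreover have "finite {(a, b) \<in> node_index d. even a \<and> even b}"
      by (rule finite_subset[OF _ finite_node_index[of d]]) blast
    ultimately have "n2 \<le> card {(a, b) \<in> node_index d. even a \<and> even b}"
      unfolding n2_def by (intro card_mono)
    then have "n2 \<le> card (node_index k)" unfolding k card_even_nodes .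
    then have "2 * real n2 \<le> real (2 * card (node_index k))" by simp
    also have "\<dots> = (real k - 1) * (real k - 2)" using \<open>k \<ge> 2\<close> by (simp only: card_node_index of_nat_mult) simp
    finally have n2: "2 * real n2 \<le> (real k - 1) * (real k - 2)" .
    have "(2 * k - 1) div 2 = k - 1" using \<open>k \<ge> 2\<close> by auto
    then have "real M = real n1 * real k + real n2 * (real k - 1)"
      using \<open>k \<ge> 2\<close> by (simp add: M_def k)
    \<comment> \<open>Every node is credited with \<open>k\<close> levels, and one is taken back for
      each maximum.\<close>
    then have "2 * real M = 2 * (real n1 + real n2) * real k - 2 * real n2" by (simp add: algebra_simps)
    also have "\<dots> \<ge> (2 * real k - 1) * (2 * real k - 2) * real k - (real k - 1) * (real k - 2)"
      unfolding nr using n2 by (simp add: k)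
    finally have "real M \<ge> ((2 * real k - 1) * (2 * real k - 2) * real k - (real k - 1) * (real k - 2)) / 2" by simp
    also have "((2 * real k - 1) * (2 * real k - 2) * real k - (real k - 1) * (real k - 2)) / 2 =
        (real d - 2) * (2 * (real d)^2 - 3 * real d + 4) / 8"
      by (simp add: k power2_eq_square) (simp add: algebra_simps)
    finally have "ereal ((real d - 2) * (2 * (real d)^2 - 3 * real d + 4) / 8) \<le> ereal (real M)"
      by (simp only: ereal_less_eq(3))
    then show "ereal ((real d - 2) * (2 * (real d)^2 - 3 * real d + 4) / 8) \<le> ereal_of_enat (mu3_A1_solitary d)"
      using M by (rule order_trans)
  qed
qed

end
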